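(* Let $d,e\ge2$ be integers, $n=de$, and let $\mathbb F$ be a field whose characteristic does not divide $d$, with algebraic closure $\overline{\mathbb F}$. The projection $\pi:\Gamma_{n,d}\to\overline{\mathbb F}^{d+e-1}\times\overline{\mathbb F}^{d+e-1}$, $(g,h,\boldsymbol\alpha,\boldsymbol\beta)\mapsto(\boldsymbol\alpha,\boldsymbol\beta)$, is dominant. In particular, for all $\boldsymbol\alpha,\boldsymbol\beta\in\overline{\mathbb F}^{d+e-1}$ with $R^{(2)}(\boldsymbol\alpha)\neq0$, the fiber $\pi^{-1}(\boldsymbol\alpha,\boldsymbol\beta)$ is of dimension zero.
   Context: $P_d(\overline{\mathbb F})$ is the set of monic polynomials of degree $d$ in $\overline{\mathbb F}[X]$ and $P_e^*(\overline{\mathbb F})$ the set of monic polynomials of degree $e$ with constant coefficient $0$; both are identified with affine spaces ($\overline{\mathbb F}^d$ and $\overline{\mathbb F}^{e-1}$) via their non-leading coefficients (omitting the constant one for $P_e^*$). The incidence variety is $$\Gamma_{n,d}=\{(g,h,\boldsymbol\alpha,\boldsymbol\beta)\in P_d(\overline{\mathbb F})\times P_e^*(\overline{\mathbb F})\times\overline{\mathbb F}^{d+e-1}\times\overline{\mathbb F}^{d+e-1}:\ (g\circ h)(\alpha_i)=\beta_i\text{ for }1\le i\le d+e-1\}.$$ Put $q=d+e-1$ and let $\boldsymbol A=(A_1,\dots,A_q)$ be indeterminates. For a set partition $\mathcal P=\{P_1,\dots,P_m\}$ of $\{1,\dots,q\}$ put $i_k=\min P_k$ and number the blocks so that $i_1<\dots<i_m$;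 consider the $q-m$ pairs $(i_k,j)$ with $1\le k\le m$ and $j\in P_k\setminus\{i_k\}$, ordered by $k$ and then by $j$. If $m=d-1$, let $R_{\mathcal P}\in\mathbb F[\boldsymbol A]$ be the determinant of the $e\times e$ matrix whose row indexed by $(i_k,j)$ is $(A_{i_k}^r-A_j^r)_{1\le r\le e}$. If $m=d$, let $S_{\mathcal P}\in\mathbb F[\boldsymbol A]$ be the determinant of the $(e-1)\times(e-1)$ matrix whose row indexed by $(i_k,j)$ is $(A_{i_k}^r-A_j^r)_{1\le r\le e-1}$. Then $R^{(2)}=\prod_{\mathcal Q}R_{\mathcal Q}\cdot\prod_{\mathcal P}S_{\mathcal P}\in\mathbb F[\boldsymbol A]$, with $\mathcal Q$ running over all partitions of $\{1,\dots,q\}$ into $d-1$ blocks and $\mathcal P$ over all partitions into $d$ blocks. *)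

theory Defs
  imports
    "HOL-Library.Poly_Mapping"
    "HOL-Library.Disjoint_Sets"
    "HOL-Library.Extended_Real"
    "HOL-Analysis.Abstract_Topology"
    "HOL-Algebra.Algebraic_Closure_Type"
    "Jordan_Normal_Form.Determinant"
begin

text \<open>HOL-Algebra uses these symbols with other meanings.\<close>

no_notation set_add (infixl \<open><+>\<index>\<close> 60)
no_notation eq_closure_of (\<open>closure'_of\<index>\<close>)


section \<open>Multivariate polynomials\<close>

text \<open>Polynomials with variables indexed by \<open>'i\<close>: finitely supported maps from monomials (exponent
  vectors) to coefficients, with the convolution product.\<close>

type_synonym ('i, 'k) mpoly = "('i \<Rightarrow>\<^sub>0 nat) \<Rightarrow>\<^sub>0 'k"

definition mvar :: "'i \<Rightarrow> ('i, 'k::comm_ring_1) mpoly" where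
  "mvar i = Poly_Mapping.single (Poly_Mapping.single i 1) 1"

definition mvars :: "('i, 'k::zero) mpoly \<Rightarrow> 'i set" where
  "mvars p = (\<Union>m\<in>Poly_Mapping.keys p. Poly_Mapping.keys m)"

text \<open>Evaluation at the point \<open>x\<close>, the coefficients being mapped to the target by \<open>\<phi>\<close>.\<close>

definition mmonom :: "('i \<Rightarrow> 'k::comm_ring_1) \<Rightarrow> ('i \<Rightarrow>\<^sub>0 nat) \<Rightarrow> 'k" where
  "mmonom x m = (\<Prod>i\<in>Poly_Mapping.keys m. x i ^ Poly_Mapping.lookup m i)"

definition meval :: "('c::zero \<Rightarrow> 'k::comm_ring_1) \<Rightarrow> ('i \<Rightarrow> 'k) \<Rightarrow> ('i, 'c) mpoly \<Rightarrow> 'k" where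
  "meval \<phi> x p = (\<Sum>m\<in>Poly_Mapping.keys p. \<phi> (Poly_Mapping.lookup p m) * mmonom x m)"

lemma mmonom_superset:
  assumes "finite J" "Poly_Mapping.keys m \<subseteq> J"
  shows "mmonom x m = (\<Prod>i\<in>J. x i ^ Poly_Mapping.lookup m i)"
  unfolding mmonom_def
  by (rule prod.mono_neutral_left) (use assms in \<open>auto simp: in_keys_iff\<close>)

lemma mmonom_add: "mmonom x (m + n) = mmonom x m * mmonom x n"
proof -
  let ?J = "Poly_Mapping.keys m \<union> Poly_Mapping.keys n"
  have "Poly_Mapping.keys (m + n) \<subseteq> ?J" by (rule Poly_Mapping.keys_add)
  then show ?thesis
    by (simp add: mmonom_superset[of ?J] lookup_add power_add prod.distrib)
qed

lemma meval_superset: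
  assumes "finite M" "Poly_Mapping.keys p \<subseteq> M" "\<phi> 0 = 0"
  shows "meval \<phi> x p = (\<Sum>m\<in>M. \<phi> (Poly_Mapping.lookup p m) * mmonom x m)"
  unfolding meval_def
  by (rule sum.mono_neutral_left) (use assms in \<open>auto simp: in_keys_iff\<close>)

lemma meval_add: "meval (\<lambda>c. c) x (p + q) = meval (\<lambda>c. c) x p + meval (\<lambda>c. c) x q"
proof -
  let ?M = "Poly_Mapping.keys p \<union> Poly_Mapping.keys q"
  have "Poly_Mapping.keys (p + q) \<subseteq> ?M" by (rule Poly_Mapping.keys_add)
  then show ?thesis
    by (simp add: meval_superset[of ?M] lookup_add algebra_simps sum.distrib)
qed

lemma meval_single: "meval (\<lambda>c. c) x (Poly_Mapping.single m a) = a * mmonom x m"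
  by (simp add: meval_def)

lemma meval_sum: "finite A \<Longrightarrow> meval (\<lambda>c. c) x (\<Sum>a\<in>A. f a) = (\<Sum>a\<in>A. meval (\<lambda>c. c) x (f a))"
  by (induction A rule: finite_induct) (auto simp: meval_add, simp add: meval_def)

lemma mpoly_as_sum:
  "p = (\<Sum>m\<in>Poly_Mapping.keys p. Poly_Mapping.single m (Poly_Mapping.lookup p m))"
  by (rule poly_mapping_eqI)
    (auto simp: lookup_sum lookup_single when_def in_keys_iff)

lemma meval_mult: "meval (\<lambda>c. c) x (p * q) = meval (\<lambda>c. c) x p * meval (\<lambda>c. c) x (q :: ('i, 'k::comm_ring_1) mpoly)"
proof -
  have "p * q = (\<Sum>m\<in>Poly_Mapping.keys p. \<Sum>n\<in>Poly_Mapping.keys q.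
          Poly_Mapping.single (m + n) (Poly_Mapping.lookup p m * Poly_Mapping.lookup q n))"
    by (subst (1) mpoly_as_sum[of p], subst (1) mpoly_as_sum[of q])
      (simp add: sum_product mult_single)
  then show ?thesis
    by (simp add: meval_sum meval_single mmonom_add)
      (simp add: meval_def sum_product mult_ac)
qed

lemma mvars_mult: "mvars (p * q) \<subseteq> mvars p \<union> mvars (q :: ('i, 'k::comm_ring_1) mpoly)"
proof
  fix i assume "i \<in> mvars (p * q)"
  then obtain m where m: "m \<in> Poly_Mapping.keys (p * q)" "i \<in> Poly_Mapping.keys m"
    by (auto simp: mvars_def)
  then obtain a b where "m = a + b" "a \<in> Poly_Mapping.keys p" "b \<in> Poly_Mapping.keys q"
    using keys_mult[of p q] by blast
  with m show "i \<in> mvars p \<union> mvars q"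
    using Poly_Mapping.keys_add[of a b] by (auto simp: mvars_def)
qed


section \<open>Affine space and the Zariski topology\<close>

text \<open>Affine space with coordinates indexed by \<open>I\<close>; a point is an extensional function on \<open>I\<close>.\<close>

definition affine_space :: "'i set \<Rightarrow> ('i \<Rightarrow> 'k) set" where
  "affine_space I = I \<rightarrow>\<^sub>E UNIV"

definition zero_locus :: "'i set \<Rightarrow> ('i, 'k::idom) mpoly set \<Rightarrow> ('i \<Rightarrow> 'k) set" where
  "zero_locus I S = {x \<in> affine_space I. \<forall>p\<in>S. meval (\<lambda>c. c) x p = 0}"

definition zariski :: "'i set \<Rightarrow> ('i \<Rightarrow> 'k::idom) topology" where
  "zariski I = topology (\<lambda>U. \<exists>S. (\<forall>p\<in>S. mvars p \<subseteq> I) \<and> U = affine_space I - zero_locus I S)"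

lemma istopology_zariski:
  "istopology (\<lambda>U. \<exists>S. (\<forall>p\<in>S. mvars p \<subseteq> I) \<and>
     U = affine_space I - zero_locus I (S :: ('i, 'k::idom) mpoly set))"
  (is "istopology ?Z")
  unfolding istopology_def
proof (intro conjI allI impI)
  fix U V assume "?Z U" "?Z V"
  then obtain S T where S: "\<forall>p\<in>S. mvars p \<subseteq> I" "U = affine_space I - zero_locus I S"
    and T: "\<forall>p\<in>T. mvars p \<subseteq> I" "V = affine_space I - zero_locus I T" by blast
  let ?ST = "{p * q | p q. p \<in> S \<and> q \<in> T}"
  have "\<forall>p\<in>?ST. mvars p \<subseteq> I"
  proof
    fix r assume "r \<in> ?ST"
    then obtain p q where "r = p * q" "p \<in> S" "q \<in> T" by blast
    then show "mvars r \<subseteq> I" using mvars_mult[of p q] S(1) T(1) by (meson le_sup_iff subset_trans)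
  qed
  moreover have "U \<inter> V = affine_space I - zero_locus I ?ST"
  proof (rule Set.set_eqI)
    fix x
    have "(\<forall>r\<in>?ST. meval (\<lambda>c. c) x r = 0) \<longleftrightarrow>
        (\<forall>p\<in>S. \<forall>q\<in>T. meval (\<lambda>c. c) x p * meval (\<lambda>c. c) x q = 0)"
      by (auto simp flip: meval_mult)
    also have "\<dots> \<longleftrightarrow> (\<forall>p\<in>S. meval (\<lambda>c. c) x p = 0) \<or> (\<forall>q\<in>T. meval (\<lambda>c. c) x q = 0)"
      by auto
    finally show "x \<in> U \<inter> V \<longleftrightarrow> x \<in> affine_space I - zero_locus I ?ST"
      unfolding S(2) T(2) zero_locus_def by simp blast
  qed
  ultimately show "?Z (U \<inter> V)" by (intro exI[of _ ?ST] conjI)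
next
  fix \<U> assume "\<forall>U\<in>\<U>. ?Z U"
  then have "\<exists>S. \<forall>U\<in>\<U>. (\<forall>p\<in>S U. mvars p \<subseteq> I) \<and> U = affine_space I - zero_locus I (S U)"
    by (rule bchoice)
  then obtain S where
    S: "\<forall>U\<in>\<U>. (\<forall>p\<in>S U. mvars p \<subseteq> I) \<and> U = affine_space I - zero_locus I (S U)"
    by (rule exE)
  have "\<Union>\<U> = (\<Union>U\<in>\<U>. U)" by simp
  also have "\<dots> = (\<Union>U\<in>\<U>. affine_space I - zero_locus I (S U))"
    by (rule SUP_cong[OF refl]) (rule bspec[OF S, THEN conjunct2])
  also have "\<dots> = affine_space I - zero_locus I (\<Union>(S ` \<U>))"
    by (auto simp: zero_locus_def)
  finally have "\<Union>\<U> = affine_space I - zero_locus I (\<Union>(S ` \<U>))" .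
  moreover have "\<forall>p\<in>\<Union>(S ` \<U>). mvars p \<subseteq> I"
    using bspec[OF S, THEN conjunct1] by blast
  ultimately show "?Z (\<Union>\<U>)" by (intro exI[of _ "\<Union>(S ` \<U>)"] conjI)
qed

lemma openin_zariski:
  "openin (zariski I) U \<longleftrightarrow> (\<exists>S. (\<forall>p\<in>S. mvars p \<subseteq> I) \<and> U = affine_space I - zero_locus I S)"
  unfolding zariski_def by (simp add: topology_inverse'[OF istopology_zariski])

lemma topspace_zariski: "topspace (zariski I :: ('i \<Rightarrow> 'k::idom) topology) = affine_space I"
proof
  show "topspace (zariski I) \<subseteq> (affine_space I :: ('i \<Rightarrow> 'k) set)"
    by (auto simp: topspace_def openin_zariski)
  have "mvars (1 :: ('i, 'k) mpoly) \<subseteq> I" by (simp add: mvars_def)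
  then have "openin (zariski I) (affine_space I - zero_locus I {1 :: ('i, 'k) mpoly})"
    unfolding openin_zariski by blast
  moreover have "zero_locus I {1 :: ('i, 'k) mpoly} = {}"
    by (simp add: zero_locus_def meval_def mmonom_def)
  ultimately show "affine_space I \<subseteq> topspace (zariski I :: ('i \<Rightarrow> 'k) topology)"
    using openin_subset by fastforce
qed

lemma closedin_zariski:
  fixes Z :: "('i \<Rightarrow> 'k::idom) set"
  shows "closedin (zariski I) Z \<longleftrightarrow> (\<exists>S. (\<forall>p\<in>S. mvars p \<subseteq> I) \<and> Z = zero_locus I S)"
proof -
  have "zero_locus I S \<subseteq> affine_space I" for S :: "('i, 'k) mpoly set"
    by (auto simp: zero_locus_def)
  then show ?thesis
    unfolding closedin_def openin_zariski topspace_zariski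
    by (metis Diff_Diff_Int Diff_subset inf.absorb_iff2)
qed

definition irreducible_space :: "'a topology \<Rightarrow> bool" where
  "irreducible_space T \<longleftrightarrow> topspace T \<noteq> {} \<and>
     (\<forall>A B. closedin T A \<longrightarrow> closedin T B \<longrightarrow> topspace T = A \<union> B \<longrightarrow>
        topspace T = A \<or> topspace T = B)"

text \<open>Supremum of the lengths \<open>n\<close> of chains \<open>Z\<^sub>0 \<subset> \<dots> \<subset> Z\<^sub>n\<close> of irreducible closed subsets. The
  value of the empty space is \<open>-\<infinity>\<close>; in particular, a space of dimension \<open>0\<close> is nonempty.\<close>

definition krull_dim :: "'a topology \<Rightarrow> ereal" where
  "krull_dim T = Sup {ereal (real n) | n.
     \<exists>Z. (\<forall>i\<le>n. closedin T (Z i) \<and> irreducible_space (subtopology T (Z i))) \<and>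
         (\<forall>i<n. Z i \<subset> Z (Suc i))}"

definition dominant :: "'a topology \<Rightarrow> 'b topology \<Rightarrow> ('a \<Rightarrow> 'b) \<Rightarrow> bool" where
  "dominant T U f \<longleftrightarrow> f \<in> topspace T \<rightarrow> topspace U \<and> U closure_of (f ` topspace T) = topspace U"


section \<open>The incidence variety\<close>

definition monic_polys :: "nat \<Rightarrow> 'k::comm_ring_1 poly set" where
  "monic_polys d = {g. degree g = d \<and> lead_coeff g = 1}"

definition monic_polys0 :: "nat \<Rightarrow> 'k::comm_ring_1 poly set" where
  "monic_polys0 e = {h \<in> monic_polys e. coeff h 0 = 0}"

definition npoints :: "nat \<Rightarrow> nat \<Rightarrow> nat" where
  "npoints d e = d + e - 1"

abbreviation (input) points :: "nat \<Rightarrow> nat \<Rightarrow> (nat \<Rightarrow> 'k) set" where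
  "points d e \<equiv> affine_space {1..npoints d e}"

type_synonym 'k tuple = "'k poly \<times> 'k poly \<times> (nat \<Rightarrow> 'k) \<times> (nat \<Rightarrow> 'k)"

definition ambient_set :: "nat \<Rightarrow> nat \<Rightarrow> 'k::comm_ring_1 tuple set" where
  "ambient_set d e = monic_polys d \<times> monic_polys0 e \<times> points d e \<times> points d e"

text \<open>The ambient space of the incidence variety and the target of the projection carry the Zariski
  topology of the affine spaces with which they are identified (not the product topology); sum
  types serve to concatenate coordinate tuples.\<close>

definition tuple_coords :: "nat \<Rightarrow> nat \<Rightarrow> 'k::comm_ring_1 tuple \<Rightarrow> (nat + nat + nat + nat \<Rightarrow> 'k)" where
  "tuple_coords d e = (\<lambda>(g, h, \<alpha>, \<beta>).
     case_sum (restrict (coeff g) {0..<d})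
       (case_sum (restrict (coeff h) {1..<e}) (case_sum \<alpha> \<beta>)))"

definition ambient :: "nat \<Rightarrow> nat \<Rightarrow> 'k::idom tuple topology" where
  "ambient d e = pullback_topology (ambient_set d e) (tuple_coords d e)
     (zariski ({0..<d} <+> {1..<e} <+> {1..npoints d e} <+> {1..npoints d e}))"

definition target :: "nat \<Rightarrow> nat \<Rightarrow> ((nat \<Rightarrow> 'k::idom) \<times> (nat \<Rightarrow> 'k)) topology" where
  "target d e = pullback_topology (points d e \<times> points d e) (\<lambda>(\<alpha>, \<beta>). case_sum \<alpha> \<beta>)
     (zariski ({1..npoints d e} <+> {1..npoints d e}))"

definition incidence :: "nat \<Rightarrow> nat \<Rightarrow> 'k::comm_ring_1 tuple set" where
  "incidence d e = {(g, h, \<alpha>, \<beta>) \<in> ambient_set d e.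
     \<forall>i\<in>{1..npoints d e}. poly (pcompose g h) (\<alpha> i) = \<beta> i}"

definition incidence_proj :: "'k tuple \<Rightarrow> (nat \<Rightarrow> 'k) \<times> (nat \<Rightarrow> 'k)" where
  "incidence_proj = (\<lambda>(g, h, \<alpha>, \<beta>). (\<alpha>, \<beta>))"

definition incidence_fiber ::
  "nat \<Rightarrow> nat \<Rightarrow> (nat \<Rightarrow> 'k::comm_ring_1) \<Rightarrow> (nat \<Rightarrow> 'k) \<Rightarrow> 'k tuple set" where
  "incidence_fiber d e \<alpha> \<beta> = {z \<in> incidence d e. incidence_proj z = (\<alpha>, \<beta>)}"


section \<open>The polynomial \<open>R\<^sup>(\<^sup>2\<^sup>)\<close>\<close>

text \<open>The pairs \<open>(i\<^sub>k, j)\<close> with \<open>i\<^sub>k\<close> the minimum of a block and \<open>j\<close> another element of that block,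
  in lexicographic order; the inner union is the block containing \<open>i\<close>.\<close>

definition block_pairs :: "nat set set \<Rightarrow> (nat \<times> nat) list" where
  "block_pairs P = concat (map
     (\<lambda>i. map (Pair i) (sorted_list_of_set (\<Union>{B \<in> P. i \<in> B} - {i})))
     (sorted_list_of_set (Min ` P)))"

text \<open>For a partition of a \<open>q\<close>-element set into \<open>m\<close> blocks and \<open>w = q - m\<close>, the list of pairs has
  length \<open>w\<close>. Rows and columns are counted from \<open>0\<close> here.\<close>

definition block_det :: "nat \<Rightarrow> nat set set \<Rightarrow> (nat, 'k::comm_ring_1) mpoly" where
  "block_det w P = det (mat w w (\<lambda>(a, r).
     mvar (fst (block_pairs P ! a)) ^ Suc r - mvar (snd (block_pairs P ! a)) ^ Suc r))"

definition R2 :: "nat \<Rightarrow> nat \<Rightarrow> (nat, 'k::comm_ring_1) mpoly" where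
  "R2 d e =
     (\<Prod>Q | partition_on {1..npoints d e} Q \<and> card Q = d - 1. block_det e Q) *
     (\<Prod>P | partition_on {1..npoints d e} P \<and> card P = d. block_det (e - 1) P)"

end

theory Submission
  imports Defs "HOL-Library.Function_Algebras"
begin

text \<open>Fix \<open>\<alpha>\<close> with \<open>R\<^sup>(\<^sup>2\<^sup>)(\<alpha>) \<noteq> 0\<close> and consider the map from pairs \<open>(g, h)\<close> to the values
  \<open>g (h (\<alpha> i))\<close>, a polynomial map of affine \<open>q\<close>-space to itself, where \<open>q = d + e - 1\<close>. It is finite:
  eliminating \<open>g\<close> by divided differences expresses the Vandermonde products of \<open>d + 1\<close> of the values
  \<open>h (\<alpha> i)\<close> by terms of lower degree in \<open>h\<close>, and as the \<open>S\<^sub>P\<close> do not vanish at \<open>\<alpha>\<close>, the leading forms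
  of these products have no common zero but \<open>0\<close>, so the coefficients of \<open>h\<close> are integral. As the \<open>R\<^sub>Q\<close>
  do not vanish, the Vandermonde products of \<open>d\<close> of the values generate the unit ideal, and
  Cramer's rule expresses the coefficients of \<open>g\<close> polynomially by those of \<open>h\<close> and the values. A
  finite polynomial map of affine \<open>q\<close>-space to itself is surjective by a dimension count, and its
  fibers are finite.\<close>


section \<open>Prime ideals of subrings\<close>

text \<open>Both g and h are unknown and the equations mix them. Counting the values
  \<open>g (h (\<alpha> i))\<close> as degree 0 removes g: the divided difference of a monic g of
  degree d at d + 1 nodes is 1, so the product of the node differences has lower degree in h than
  its number of factors. To leading order the nodes therefore fall into at most d classes, and two
  nodes of one class give a linear equation for the coefficients of h. To leading order the constant
  contributed by X^e drops out, which leaves e - 1 unknowns and the matrix of S. Once h is integral,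
  d nodes are used and the equations hold exactly; the leading coefficient 1 of h then acts as one
  more unknown, the matrix is that of R, and its invertibility puts 1 in a proper ideal. Leading
  order is made precise by a prime of a Rees ring that contains T but not a given coefficient times
  T. Surjectivity reduces to a common zero because the prescribed values are subtracted from the
  components beforehand.\<close>

definition subring_set :: "'r::comm_ring_1 set \<Rightarrow> bool" where
  "subring_set S \<longleftrightarrow> 1 \<in> S \<and> (\<forall>a\<in>S. \<forall>b\<in>S. a - b \<in> S \<and> a * b \<in> S)"

definition ideal_set :: "'r::comm_ring_1 set \<Rightarrow> 'r set \<Rightarrow> bool" where
  "ideal_set S I \<longleftrightarrow> I \<subseteq> S \<and> 0 \<in> I \<and> (\<forall>a\<in>I. \<forall>b\<in>I. a + b \<in> I) \<and> (\<forall>s\<in>S. \<forall>a\<in>I. s * a \<in> I)"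

definition prime_set :: "'r::comm_ring_1 set \<Rightarrow> 'r set \<Rightarrow> bool" where
  "prime_set S I \<longleftrightarrow> ideal_set S I \<and> 1 \<notin> I \<and> (\<forall>a\<in>S. \<forall>b\<in>S. a * b \<in> I \<longrightarrow> a \<in> I \<or> b \<in> I)"

lemma subring_setD:
  assumes "subring_set S"
  shows "1 \<in> S" "0 \<in> S" "a \<in> S \<Longrightarrow> b \<in> S \<Longrightarrow> a - b \<in> S" "a \<in> S \<Longrightarrow> b \<in> S \<Longrightarrow> a * b \<in> S"
    "a \<in> S \<Longrightarrow> - a \<in> S" "a \<in> S \<Longrightarrow> b \<in> S \<Longrightarrow> a + b \<in> S" "a \<in> S \<Longrightarrow> a ^ n \<in> S"
proof -
  show 1: "1 \<in> S" and diff: "a \<in> S \<Longrightarrow> b \<in> S \<Longrightarrow> a - b \<in> S"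
    and mult: "a \<in> S \<Longrightarrow> b \<in> S \<Longrightarrow> a * b \<in> S" for a b
    using assms by (auto simp: subring_set_def)
  show 0: "0 \<in> S" using diff[OF 1 1] by simp
  show neg: "a \<in> S \<Longrightarrow> - a \<in> S" for a using diff[OF 0, of a] by simp
  show "a \<in> S \<Longrightarrow> b \<in> S \<Longrightarrow> a + b \<in> S" using diff[of a "- b"] neg[of b] by simp
  show "a \<in> S \<Longrightarrow> a ^ n \<in> S" by (induction n) (auto intro: 1 mult)
qed

lemma subring_set_sum: "subring_set S \<Longrightarrow> (\<And>i. i \<in> A \<Longrightarrow> f i \<in> S) \<Longrightarrow> sum f A \<in> S"
  by (induction A rule: infinite_finite_induct) (auto intro: subring_setD)

lemma subring_set_prod: "subring_set S \<Longrightarrow> (\<And>i. i \<in> A \<Longrightarrow> f i \<in> S) \<Longrightarrow> prod f A \<in> S"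
  by (induction A rule: infinite_finite_induct) (auto intro: subring_setD)

lemma ideal_setD:
  assumes "ideal_set S I"
  shows "0 \<in> I" "a \<in> I \<Longrightarrow> a \<in> S" "a \<in> I \<Longrightarrow> b \<in> I \<Longrightarrow> a + b \<in> I"
    "s \<in> S \<Longrightarrow> a \<in> I \<Longrightarrow> s * a \<in> I" "s \<in> S \<Longrightarrow> a \<in> I \<Longrightarrow> a * s \<in> I"
  using assms by (auto simp: ideal_set_def mult.commute)

lemma ideal_set_uminus: "subring_set S \<Longrightarrow> ideal_set S I \<Longrightarrow> a \<in> I \<Longrightarrow> - a \<in> I"
  using ideal_setD(4)[of S I "- 1" a] subring_setD(1,5)[of S] by simp

lemma ideal_set_diff: "subring_set S \<Longrightarrow> ideal_set S I \<Longrightarrow> a \<in> I \<Longrightarrow> b \<in> I \<Longrightarrow> a - b \<in> I"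
  using ideal_setD(3)[of S I a "- b"] ideal_set_uminus[of S I b] by simp

lemma ideal_set_sum: "ideal_set S I \<Longrightarrow> (\<And>i. i \<in> A \<Longrightarrow> f i \<in> I) \<Longrightarrow> sum f A \<in> I"
  by (induction A rule: infinite_finite_induct) (auto intro: ideal_setD)

lemma prime_set_prod:
  assumes "subring_set S" "prime_set S M" "finite A" "\<And>i. i \<in> A \<Longrightarrow> f i \<in> S" "prod f A \<in> M"
  shows "\<exists>i\<in>A. f i \<in> M"
  using assms(3-5)
proof (induction A rule: finite_induct)
  case empty
  then show ?case using assms(2) by (simp add: prime_set_def)
next
  case (insert x A)
  have "prod f A \<in> S" by (rule subring_set_prod) (use assms insert in auto)
  then have "f x \<in> M \<or> prod f A \<in> M"
    using assms(2) insert by (auto simp: prime_set_def)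
  then show ?case using insert by auto
qed

text \<open>By Zorn there is a maximal ideal among those that contain \<open>I\<close> and miss all
  powers of \<open>x\<close>. Two elements outside it each bring in a power of \<open>x\<close> when
  adjoined; the product of these powers is again a power, so the product of the two elements cannot
  lie in the ideal. With \<open>x = 1\<close> this gives a prime above a proper ideal, with other
  \<open>x\<close> it serves to prove nilpotency modulo \<open>I\<close>.\<close>

lemma prime_ideal_avoiding_powers:
  assumes S: "subring_set S" and I: "ideal_set S I" and x: "\<And>n. x ^ n \<notin> I"
  obtains M where "prime_set S M" "I \<subseteq> M" "x \<notin> M"
proof -
  define \<M> where "\<M> = {M. ideal_set S M \<and> I \<subseteq> M \<and> (\<forall>n. x ^ n \<notin> M)}"
  have "\<exists>M\<in>\<M>. \<forall>U\<in>\<M>. M \<subseteq> U \<longrightarrow> U = M"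
  proof (rule subset_Zorn_nonempty)
    show "\<M> \<noteq> {}" using I x by (auto simp: \<M>_def)
    fix \<C> assume ne: "\<C> \<noteq> {}" and ch: "subset.chain \<M> \<C>"
    then have sub: "\<C> \<subseteq> \<M>" and lin: "\<And>A B. A \<in> \<C> \<Longrightarrow> B \<in> \<C> \<Longrightarrow> A \<subseteq> B \<or> B \<subseteq> A"
      by (auto simp: subset_chain_def)
    obtain C0 where C0: "C0 \<in> \<C>" using ne by blast
    have "a + b \<in> \<Union>\<C>" if "a \<in> A" "A \<in> \<C>" "b \<in> B" "B \<in> \<C>" for a b A B
    proof -
      have "ideal_set S A" "ideal_set S B" using that sub by (auto simp: \<M>_def)
      then show ?thesis using lin[OF that(2,4)] that ideal_setD(3)[of S A a b] ideal_setD(3)[of S B a b] by blast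
    qed
    moreover have id: "ideal_set S A" "I \<subseteq> A" "x ^ n \<notin> A" if "A \<in> \<C>" for A n
      using that sub by (auto simp: \<M>_def)
    ultimately have "ideal_set S (\<Union>\<C>)"
      unfolding ideal_set_def[of S "\<Union>\<C>"]
    proof (intro conjI ballI subsetI)
      show "a \<in> S" if "a \<in> \<Union>\<C>" for a using that ideal_setD(2)[OF id(1)] by blast
      show "0 \<in> \<Union>\<C>" using ideal_setD(1)[OF id(1)[OF C0]] C0 by blast
      show "s * a \<in> \<Union>\<C>" if "s \<in> S" "a \<in> \<Union>\<C>" for s a
        using that ideal_setD(4)[OF id(1) that(1)] by blast
    qed blast
    then show "\<Union>\<C> \<in> \<M>" using id(2)[OF C0] id(3) C0 by (auto simp: \<M>_def)
  qed
  then obtain M where M: "M \<in> \<M>" and max: "\<And>U. U \<in> \<M> \<Longrightarrow> M \<subseteq> U \<Longrightarrow> U = M" by blast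
  have iM: "ideal_set S M" "I \<subseteq> M" "\<And>n. x ^ n \<notin> M" using M by (auto simp: \<M>_def)
  have ext: "\<exists>n. \<exists>m\<in>M. \<exists>s\<in>S. x ^ n = m + s * a" if a: "a \<in> S" "a \<notin> M" for a
  proof -
    define N where "N = {m + s * a | m s. m \<in> M \<and> s \<in> S}"
    have "m + s * a \<in> S" if "m \<in> M" "s \<in> S" for m s
      using that iM(1) a subring_setD(4,6)[OF S] ideal_setD(2)[OF iM(1)] by simp
    moreover have "0 \<in> N"
    proof -
      have "0 = 0 + 0 * a" by simp
      then show ?thesis unfolding N_def using ideal_setD(1)[OF iM(1)] subring_setD(2)[OF S] by blast
    qed
    moreover have "u + v \<in> N" if uv: "u \<in> N" "v \<in> N" for u v
    proof -
      obtain m s m' s' where e: "u = m + s * a" "v = m' + s' * a" "m \<in> M" "m' \<in> M" "s \<in> S" "s' \<in> S"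
        using uv unfolding N_def by blast
      have "u + v = (m + m') + (s + s') * a" by (simp add: e algebra_simps)
      then show ?thesis unfolding N_def using e subring_setD(6)[OF S] ideal_setD(3)[OF iM(1)] by blast
    qed
    moreover have "r * u \<in> N" if ru: "r \<in> S" "u \<in> N" for r u
    proof -
      obtain m s where e: "u = m + s * a" "m \<in> M" "s \<in> S" using ru unfolding N_def by blast
      have "r * u = r * m + (r * s) * a" by (simp add: e algebra_simps)
      then show ?thesis unfolding N_def using e ru subring_setD(4)[OF S] ideal_setD(4)[OF iM(1)] by blast
    qed
    ultimately have N: "ideal_set S N" unfolding ideal_set_def by (auto simp: N_def)
    have "M \<subseteq> N"
    proof
      fix m assume "m \<in> M"
      moreover have "m = m + 0 * a" by simp
      ultimately show "m \<in> N" unfolding N_def using subring_setD(2)[OF S] by blast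
    qed
    moreover have "a \<in> N"
    proof -
      have "a = 0 + 1 * a" by simp
      then show ?thesis unfolding N_def using subring_setD(1)[OF S] ideal_setD(1)[OF iM(1)] by blast
    qed
    ultimately have "N \<notin> \<M>" using max[of N] a by blast
    then obtain n where "x ^ n \<in> N" using N \<open>M \<subseteq> N\<close> iM(2) by (auto simp: \<M>_def)
    then show ?thesis by (auto simp: N_def)
  qed
  have "prime_set S M"
    unfolding prime_set_def
  proof (intro conjI ballI impI)
    show "1 \<notin> M" using iM(3)[of 0] by simp
    fix a b assume ab: "a \<in> S" "b \<in> S" "a * b \<in> M"
    show "a \<in> M \<or> b \<in> M"
    proof (rule ccontr)
      assume "\<not> (a \<in> M \<or> b \<in> M)"
      then have "a \<notin> M" "b \<notin> M" by auto
      from ext[OF ab(1) this(1)] ext[OF ab(2) this(2)]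
      obtain n m s n' m' s' where e: "x ^ n = m + s * a" "m \<in> M" "s \<in> S"
        "x ^ n' = m' + s' * b" "m' \<in> M" "s' \<in> S"
        by blast
      have "x ^ (n + n') = (m + s * a) * m' + (s' * b) * m + (s * s') * (a * b)"
        unfolding power_add e(1,4) by (simp add: algebra_simps)
      also have "\<dots> \<in> M"
      proof (rule ideal_setD(3)[OF iM(1)], rule ideal_setD(3)[OF iM(1)])
        have "m \<in> S" using e ideal_setD(2)[OF iM(1)] by blast
        then have "m + s * a \<in> S" by (intro subring_setD(4,6)[OF S] e ab)
        then show "(m + s * a) * m' \<in> M" by (intro ideal_setD(4)[OF iM(1)] e)
        show "s' * b * m \<in> M" by (intro ideal_setD(4)[OF iM(1)] subring_setD(4)[OF S] e ab)
        show "s * s' * (a * b) \<in> M"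
          by (rule ideal_setD(4)[OF iM(1)]) (intro subring_setD(4)[OF S] e ab)+
      qed
      finally show False using iM(3) by blast
    qed
  qed (fact iM)
  then show ?thesis using that iM(2) iM(3)[of 1] by simp
qed


section \<open>Newton interpolation without division\<close>

definition vand :: "(nat \<Rightarrow> 'r::comm_ring_1) \<Rightarrow> nat \<Rightarrow> 'r" where
  "vand \<eta> n = (\<Prod>j<n. \<Prod>i<j. \<eta> j - \<eta> i)"

lemma vand_Suc: "vand \<eta> (Suc n) = vand \<eta> n * (\<Prod>i<n. \<eta> n - \<eta> i)"
  by (simp add: vand_def)

text \<open>Used twice: for the degree filtration \<open>Q\<close>, where the index carries the
  information, and for a constant family on a subring, where only membership is left.\<close>

definition filtration :: "(nat \<Rightarrow> 'r::comm_ring_1 set) \<Rightarrow> bool" where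
  "filtration Q \<longleftrightarrow> (\<forall>m. \<forall>a\<in>Q m. \<forall>b\<in>Q m. a - b \<in> Q m) \<and> 1 \<in> Q 0 \<and> mono Q \<and>
     (\<forall>m n. \<forall>a\<in>Q m. \<forall>b\<in>Q n. a * b \<in> Q (m + n))"

lemma filtrationD:
  assumes "filtration Q"
  shows "1 \<in> Q m" "0 \<in> Q m" "a \<in> Q m \<Longrightarrow> b \<in> Q m \<Longrightarrow> a - b \<in> Q m" "a \<in> Q m \<Longrightarrow> - a \<in> Q m"
    "a \<in> Q m \<Longrightarrow> b \<in> Q m \<Longrightarrow> a + b \<in> Q m" "a \<in> Q m \<Longrightarrow> b \<in> Q n \<Longrightarrow> a * b \<in> Q (m + n)"
    "m \<le> n \<Longrightarrow> a \<in> Q m \<Longrightarrow> a \<in> Q n"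
proof -
  show mono: "m \<le> n \<Longrightarrow> a \<in> Q m \<Longrightarrow> a \<in> Q n" for m n a
    using assms by (auto simp: filtration_def dest: monoD)
  show 1: "1 \<in> Q m" using mono[of 0 m] assms by (auto simp: filtration_def)
  show diff: "a \<in> Q m \<Longrightarrow> b \<in> Q m \<Longrightarrow> a - b \<in> Q m" for a b
    using assms by (auto simp: filtration_def)
  show 0: "0 \<in> Q m" using diff[OF 1 1] by simp
  show neg: "a \<in> Q m \<Longrightarrow> - a \<in> Q m" for a using diff[OF 0, of a] by simp
  show "a \<in> Q m \<Longrightarrow> b \<in> Q m \<Longrightarrow> a + b \<in> Q m" using diff[of a "- b"] neg[of b] by simp
  show "a \<in> Q m \<Longrightarrow> b \<in> Q n \<Longrightarrow> a * b \<in> Q (m + n)" using assms by (auto simp: filtration_def)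
qed

lemma filtration_prod:
  assumes "filtration Q" "finite A" "\<And>i. i \<in> A \<Longrightarrow> f i \<in> Q 1"
  shows "prod f A \<in> Q (card A)"
  using assms(2,3)
proof (induction A rule: finite_induct)
  case (insert x A)
  then show ?case using filtrationD(6)[OF assms(1), of "f x" 1 "prod f A" "card A"] by simp
qed (simp add: filtrationD(1)[OF assms(1)])

lemma filtration_sum: "filtration Q \<Longrightarrow> (\<And>i. i \<in> A \<Longrightarrow> f i \<in> Q m) \<Longrightarrow> sum f A \<in> Q m"
  by (induction A rule: infinite_finite_induct) (auto intro: filtrationD)

text \<open>The coefficients are read off the Newton form, the divisions by differences of nodes being
  cleared by the Vandermonde determinant.\<close>

lemma vand_mult_coeff:
  assumes Q: "filtration Q"
    and "\<And>k. k \<ge> n \<Longrightarrow> coeff f k = 0" "\<And>i. i < n \<Longrightarrow> \<eta> i \<in> Q 1"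
      "\<And>i. i < n \<Longrightarrow> poly f (\<eta> i) \<in> Q m" "j < n"
  shows "vand \<eta> n * coeff f j \<in> Q (m + (\<Sum>i<n. i) - j)"
  using assms(2-)
proof (induction n arbitrary: f m j)
  case (Suc n)
  \<comment> \<open>One Newton step: \<open>f1\<close> is the divided difference of \<open>f\<close>
    with respect to the last node, and \<open>u\<close> clears the denominators of its values at the
    remaining nodes.\<close>
  define f1 where "f1 = synthetic_div f (\<eta> n)"
  define u where "u = (\<Prod>i<n. \<eta> n - \<eta> i)"
  let ?s = "\<Sum>i<n. i"
  have f: "f + smult (\<eta> n) f1 = pCons (poly f (\<eta> n)) f1"
    using synthetic_div_correct[of f "\<eta> n"] by (simp add: f1_def)
  have c0: "coeff f 0 = poly f (\<eta> n) - \<eta> n * coeff f1 0"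
    using arg_cong[OF f, of "\<lambda>p. coeff p 0"] by (simp add: eq_diff_eq)
  have cS: "coeff f (Suc k) = coeff f1 k - \<eta> n * coeff f1 (Suc k)" for k
    using arg_cong[OF f, of "\<lambda>p. coeff p (Suc k)"] by (simp add: eq_diff_eq)
  have f1_0: "coeff f1 k = 0" if "k \<ge> n" for k
  proof -
    have "degree f1 = degree f - 1" by (simp add: f1_def degree_synthetic_div)
    moreover have "degree f \<le> n" using Suc.prems(1) by (intro degree_le) auto
    ultimately have "coeff f1 k = 0 \<or> n = 0 \<and> k = 0"
      using that by (cases "k = 0") (auto intro: coeff_eq_0)
    moreover have "f1 = 0" if "n = 0"
    proof -
      have "degree f = 0" using \<open>degree f \<le> n\<close> that by simp
      then show ?thesis by (simp add: f1_def synthetic_div_eq_0_iff)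
    qed
    ultimately show ?thesis by auto
  qed
  have val: "(\<eta> n - \<eta> i) * poly f1 (\<eta> i) = poly f (\<eta> n) - poly f (\<eta> i)" for i
    using arg_cong[OF f, of "\<lambda>p. poly p (\<eta> i)"] by (simp add: algebra_simps)
  have "vand \<eta> n * coeff (smult u f1) k \<in> Q (m + (n - 1) + ?s - k)" if "k < n" for k
  proof (rule Suc.IH)
    show "coeff (smult u f1) k = 0" if "k \<ge> n" for k using f1_0 that by simp
    show "\<eta> i \<in> Q 1" if "i < n" for i using Suc.prems that by simp
    fix i assume i: "i < n"
    \<comment> \<open>The factor of \<open>u\<close> that belongs to the node \<open>i\<close> turns
      the value of \<open>f1\<close> into a difference of values of \<open>f\<close>; the other
      \<open>n - 1\<close> factors raise the index by \<open>n - 1\<close>.\<close>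
    have "u = (\<eta> n - \<eta> i) * (\<Prod>i\<in>{..<n} - {i}. \<eta> n - \<eta> i)"
      unfolding u_def using i by (intro prod.remove) auto
    then have "poly (smult u f1) (\<eta> i) =
        ((\<eta> n - \<eta> i) * poly f1 (\<eta> i)) * (\<Prod>i\<in>{..<n} - {i}. \<eta> n - \<eta> i)"
      by (simp only: poly_smult mult_ac)
    also have "\<dots> = (poly f (\<eta> n) - poly f (\<eta> i)) * (\<Prod>i\<in>{..<n} - {i}. \<eta> n - \<eta> i)"
      by (simp only: val)
    also have "\<dots> \<in> Q (m + card ({..<n} - {i}))"
      using i Suc.prems by (intro filtrationD(3,6)[OF Q] filtration_prod[OF Q]) auto
    finally show "poly (smult u f1) (\<eta> i) \<in> Q (m + (n - 1))" using i by simp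
  qed (fact that)
  then have IH: "vand \<eta> (Suc n) * coeff f1 k \<in> Q (m + (\<Sum>i<Suc n. i) - Suc k)" for k
  proof (cases "k < n")
    case True
    then have "m + (n - 1) + ?s - k = m + (\<Sum>i<Suc n. i) - Suc k" by simp
    then show ?thesis using True \<open>\<And>k. k < n \<Longrightarrow> _\<close>[of k] by (simp add: vand_Suc u_def mult_ac)
  qed (simp add: f1_0 filtrationD(2)[OF Q])
  \<comment> \<open>For these \<open>k\<close> the truncated subtraction of \<open>k\<close> in the
    index of the claim loses nothing.\<close>
  have le: "k \<le> (\<Sum>i<Suc n. i)" if "k \<le> n" for k
    using that by simp
  have eta: "\<eta> n * (vand \<eta> (Suc n) * coeff f1 k) \<in> Q (m + (\<Sum>i<Suc n. i) - k)" if "k < n" for k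
  proof -
    have "1 + (m + (\<Sum>i<Suc n. i) - Suc k) = m + (\<Sum>i<Suc n. i) - k" using le[of "Suc k"] that by simp
    moreover have "\<eta> n * (vand \<eta> (Suc n) * coeff f1 k) \<in> Q (1 + (m + (\<Sum>i<Suc n. i) - Suc k))"
      using Suc.prems IH by (intro filtrationD(6)[OF Q]) auto
    ultimately show ?thesis by simp
  qed
  have eta: "\<eta> n * (vand \<eta> (Suc n) * coeff f1 k) \<in> Q (m + (\<Sum>i<Suc n. i) - k)" for k
    using eta[of k] f1_0[of k] by (cases "k < n") (auto simp: filtrationD(2)[OF Q])
  show ?case
  proof (cases j)
    case 0
    have "vand \<eta> (Suc n) \<in> Q (\<Sum>i<Suc n. i)"
    proof -
      have "vand \<eta> N \<in> Q (\<Sum>i<N. i)" if "N \<le> Suc n" for N using that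
      proof (induction N)
        case (Suc N)
        have "(\<Prod>i<N. \<eta> N - \<eta> i) \<in> Q (card {..<N})"
          using Suc.prems \<open>\<And>i. i < Suc n \<Longrightarrow> \<eta> i \<in> Q 1\<close>
          by (intro filtration_prod[OF Q] filtrationD(3)[OF Q]) auto
        then show ?case using Suc filtrationD(6)[OF Q, of "vand \<eta> N" "\<Sum>i<N. i" _ N]
          by (simp add: vand_Suc)
      qed (simp add: vand_def filtrationD(1)[OF Q])
      then show ?thesis by blast
    qed
    then have "poly f (\<eta> n) * vand \<eta> (Suc n) \<in> Q (m + (\<Sum>i<Suc n. i))"
      using Suc.prems by (intro filtrationD(6)[OF Q]) auto
    then show ?thesis
      using filtrationD(3)[OF Q, OF _ eta[of 0]] by (simp add: 0 c0 algebra_simps)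
  next
    case (Suc k)
    have "vand \<eta> (Suc n) * coeff f1 k - \<eta> n * (vand \<eta> (Suc n) * coeff f1 (Suc k))
        \<in> Q (m + (\<Sum>i<Suc n. i) - Suc k)"
      by (rule filtrationD(3)[OF Q IH eta])
    then show ?thesis by (simp add: Suc cS algebra_simps)
  qed
qed simp

lemma prime_vand:
  assumes S: "subring_set S" and M: "prime_set S M" and z: "\<And>i. i < n \<Longrightarrow> z i \<in> S"
    and "vand z n \<in> M"
  obtains i j where "i < j" "j < n" "z j - z i \<in> M"
proof -
  have "\<exists>j\<in>{..<n}. (\<Prod>i<j. z j - z i) \<in> M"
  proof (rule prime_set_prod[OF S M])
    show "(\<Prod>i<j. z j - z i) \<in> S" if "j \<in> {..<n}" for j
      using that z by (intro subring_set_prod[OF S] subring_setD(3)[OF S]) auto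
    show "(\<Prod>j<n. \<Prod>i<j. z j - z i) \<in> M" using assms(4) by (simp add: vand_def)
  qed simp
  then obtain j where j: "j < n" "(\<Prod>i<j. z j - z i) \<in> M" by blast
  have "\<exists>i\<in>{..<j}. z j - z i \<in> M"
  proof (rule prime_set_prod[OF S M])
    show "z j - z i \<in> S" if "i \<in> {..<j}" for i
      using that z j by (intro subring_setD(3)[OF S]) auto
  qed (use j in auto)
  then show ?thesis using j that by blast
qed

text \<open>Congruence modulo a prime may have fewer classes than the number of blocks for which a
  determinant is assumed nonzero; refining the classes keeps the elements of a block congruent. One
  point at a time is split off, which is possible as long as some block is not a singleton.\<close>

lemma partition_on_refine:
  assumes "finite U" "partition_on U P" "card P \<le> m" "m \<le> card U"
  obtains P' where "partition_on U P'" "card P' = m" "\<And>B. B \<in> P' \<Longrightarrow> \<exists>C\<in>P. B \<subseteq> C"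
proof -
  have "\<exists>P'. partition_on U P' \<and> card P' = m \<and> (\<forall>B\<in>P'. \<exists>C\<in>P. B \<subseteq> C)"
    using assms(2,3)
  proof (induction "m - card P" arbitrary: P)
    case 0
    then show ?case by (intro exI[of _ P]) auto
  next
    case (Suc k)
    have fin: "finite P" using finite_elements[OF assms(1) Suc.prems(1)] .
    have part: "\<Union>P = U" "{} \<notin> P" "disjoint P" using Suc.prems by (auto simp: partition_on_def)
    have "\<exists>B\<in>P. \<exists>x\<in>B. B \<noteq> {x}"
    proof (rule ccontr)
      assume neg: "\<not> ?thesis"
      have "P = (\<lambda>x. {x}) ` U"
      proof (intro equalityI subsetI)
        fix B assume B: "B \<in> P"
        then obtain x where "x \<in> B" using part by fastforce
        then have "B = {x}" "x \<in> U" using neg B part by blast+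
        then show "B \<in> (\<lambda>x. {x}) ` U" by blast
      next
        fix B assume "B \<in> (\<lambda>x. {x}) ` U"
        then obtain x where x: "x \<in> U" "B = {x}" by blast
        then obtain C where "C \<in> P" "x \<in> C" using part by blast
        then have "C = {x}" using neg by blast
        then show "B \<in> P" using \<open>C \<in> P\<close> x by simp
      qed
      then have "card P = card U" by (simp add: card_image)
      then show False using Suc.hyps Suc.prems assms by linarith
    qed
    then obtain B x where B: "B \<in> P" "x \<in> B" "B \<noteq> {x}" by blast
    define P1 where "P1 = insert {x} (insert (B - {x}) (P - {B}))"
    have dj: "C \<inter> B = {}" if "C \<in> P - {B}" for C using that B part by (auto simp: disjoint_def)
    have n1: "{x} \<notin> P - {B}" "B - {x} \<notin> P - {B}" using dj B by blast+
    have "{x} \<noteq> B - {x}" by blast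
    have card: "card P1 = Suc (card P)"
    proof -
      have "card P = Suc (card (P - {B}))" using fin B(1) by (rule card.remove)
      then show ?thesis using n1 \<open>{x} \<noteq> B - {x}\<close> fin by (simp add: P1_def)
    qed
    have "partition_on U P1"
    proof (rule partition_onI)
      show "\<Union>P1 = U" using part B by (auto simp: P1_def)
      show "{} \<notin> P1" using part B by (auto simp: P1_def)
      show "disjnt p q" if pq: "p \<in> P1" "q \<in> P1" "p \<noteq> q" for p q
      proof -
        have dP: "disjnt C D" if "C \<in> P - {B}" "D \<in> P - {B}" "C \<noteq> D" for C D
          using that part by (auto simp: disjoint_def disjnt_def)
        have dx: "disjnt C {x}" "disjnt C (B - {x})" if "C \<in> P - {B}" for C
          using dj[OF that] B by (auto simp: disjnt_def)
        have d0: "disjnt {x} (B - {x})" by (simp add: disjnt_def)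
        have "p \<in> P - {B} \<or> p = {x} \<or> p = B - {x}" "q \<in> P - {B} \<or> q = {x} \<or> q = B - {x}"
          using pq by (auto simp: P1_def)
        then show ?thesis using dP dx d0 pq(3) by (elim disjE) (metis disjnt_sym)+
      qed
    qed
    have "k = m - card P1" "card P1 \<le> m" using Suc.hyps(2) card by linarith+
    from Suc.hyps(1)[OF this(1) \<open>partition_on U P1\<close> this(2)]
    obtain P' where "partition_on U P'" "card P' = m" and r: "\<forall>B\<in>P'. \<exists>C\<in>P1. B \<subseteq> C"
      by blast
    moreover have "\<exists>D\<in>P. C \<subseteq> D" if "C \<in> P1" for C using that B by (auto simp: P1_def)
    ultimately have "\<forall>B\<in>P'. \<exists>D\<in>P. B \<subseteq> D" by (metis order_trans)
    then show ?case using \<open>partition_on U P'\<close> \<open>card P' = m\<close> by blast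
  qed
  then show ?thesis using that by blast
qed

text \<open>Congruence modulo \<open>M\<close> is an equivalence relation on the nodes with at most \<open>n\<close> classes, as any
  \<open>n + 1\<close> nodes contain two congruent ones.\<close>

lemma vand_partition:
  assumes S: "subring_set S" and M: "prime_set S M" and U: "finite U" "n \<le> card U"
    and z: "\<And>i. i \<in> U \<Longrightarrow> z i \<in> S"
    and V: "\<And>\<sigma>. inj_on \<sigma> {..<Suc n} \<Longrightarrow> \<sigma> ` {..<Suc n} \<subseteq> U \<Longrightarrow> vand (z \<circ> \<sigma>) (Suc n) \<in> M"
  obtains P where "partition_on U P" "card P = n" "\<And>B i j. B \<in> P \<Longrightarrow> i \<in> B \<Longrightarrow> j \<in> B \<Longrightarrow> z i - z j \<in> M"
proof -
  have iM: "ideal_set S M" using M by (simp add: prime_set_def)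
  define r where "r = {(i, j). i \<in> U \<and> j \<in> U \<and> z i - z j \<in> M}"
  have "equiv U r"
  proof (rule equivI)
    show "r \<subseteq> U \<times> U" by (auto simp: r_def)
    show "refl_on U r" by (auto simp: r_def refl_on_def ideal_setD(1)[OF iM])
    show "sym r" 
    proof (rule symI)
      fix i j assume "(i, j) \<in> r"
      then show "(j, i) \<in> r" using ideal_set_uminus[OF S iM, of "z i - z j"] by (auto simp: r_def)
    qed
    show "trans r"
    proof (rule transI)
      fix i j k assume "(i, j) \<in> r" "(j, k) \<in> r"
      then show "(i, k) \<in> r" using ideal_setD(3)[OF iM, of "z i - z j" "z j - z k"] by (auto simp: r_def)
    qed
  qed
  then have part: "partition_on U (U // r)" by (rule partition_on_quotient)
  have "card (U // r) \<le> n"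
  proof (rule ccontr)
    assume "\<not> ?thesis"
    then have "Suc n \<le> card (U // r)" by simp
    moreover have fin: "finite (U // r)" using finite_elements[OF U(1) part] .
    ultimately obtain T where T: "T \<subseteq> U // r" "card T = Suc n" "finite T"
      by (meson obtain_subset_with_card_n)
    then obtain \<tau> where tau: "bij_betw \<tau> {..<Suc n} T"
      using ex_bij_betw_nat_finite[OF T(3)] by (auto simp: atLeast0LessThan)
    define \<sigma> where "\<sigma> k = (SOME x. x \<in> \<tau> k)" for k
    have tin: "\<tau> k \<in> U // r" if "k < Suc n" for k using that tau T bij_betwE by blast
    have sig: "\<sigma> k \<in> \<tau> k" if "k < Suc n" for k
    proof -
      have "\<tau> k \<noteq> {}" using tin[OF that] part by (auto simp: partition_on_def)
      then show ?thesis unfolding \<sigma>_def by (meson ex_in_conv someI_ex)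
    qed
    have ne: "(\<sigma> k, \<sigma> l) \<notin> r" if "k < Suc n" "l < Suc n" "k \<noteq> l" for k l
    proof
      assume "(\<sigma> k, \<sigma> l) \<in> r"
      then have "\<tau> k = \<tau> l"
        using quotient_eq_iff[OF \<open>equiv U r\<close> tin tin sig sig] that by blast
      then show False using that tau by (auto simp: bij_betw_def inj_on_def)
    qed
    have sX: "\<sigma> k \<in> U" if "k < Suc n" for k
      using sig[OF that] tin[OF that] part by (auto simp: partition_on_def)
    have "inj_on \<sigma> {..<Suc n}"
    proof (rule inj_onI)
      fix k l assume "k \<in> {..<Suc n}" "l \<in> {..<Suc n}" "\<sigma> k = \<sigma> l"
      moreover have "(\<sigma> k, \<sigma> k) \<in> r" if "k < Suc n" for k
        using sX[OF that] by (simp add: r_def ideal_setD(1)[OF iM])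
      ultimately show "k = l" using ne[of k l] by auto
    qed
    then have "vand (z \<circ> \<sigma>) (Suc n) \<in> M" using sX by (intro V) auto
    then obtain i j where "i < j" "j < Suc n" "(z \<circ> \<sigma>) j - (z \<circ> \<sigma>) i \<in> M"
      using z sX by (elim prime_vand[OF S M, rotated]) auto
    then show False using ne[of j i] sX by (auto simp: r_def)
  qed
  then obtain P where P: "partition_on U P" "card P = n" "\<And>B. B \<in> P \<Longrightarrow> \<exists>C\<in>U // r. B \<subseteq> C"
    using partition_on_refine[OF U(1) part _ U(2)] by metis
  have "z i - z j \<in> M" if B: "B \<in> P" "i \<in> B" "j \<in> B" for B i j
  proof -
    obtain C where "C \<in> U // r" "i \<in> C" "j \<in> C" using P(3) B by blast
    then have "(i, j) \<in> r" using quotient_eq_iff[OF \<open>equiv U r\<close>] by metis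
    then show ?thesis by (simp add: r_def)
  qed
  then show ?thesis using that P by blast
qed


section \<open>Finite polynomial maps of affine space\<close>

definition fscale :: "'k::field \<Rightarrow> ('t \<Rightarrow> 'k) \<Rightarrow> 't \<Rightarrow> 'k" where
  "fscale c f = (\<lambda>x. c * f x)"

lemma fscale_apply [simp]: "fscale c f x = c * f x"
  by (simp add: fscale_def)

interpretation fs: vector_space fscale
  by unfold_locales (auto simp: fun_eq_iff algebra_simps)

lemma fun_sum_apply: "(\<Sum>i\<in>A. f i) x = (\<Sum>i\<in>A. f i x)" for f :: "'i \<Rightarrow> 't \<Rightarrow> 'k::comm_monoid_add"
  by (induction A rule: infinite_finite_induct) auto

lemma fun_prod_apply: "(\<Prod>i\<in>A. f i) x = (\<Prod>i\<in>A. f i x)" for f :: "'i \<Rightarrow> 't \<Rightarrow> 'k::comm_monoid_mult"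
  by (induction A rule: infinite_finite_induct) auto

lemma fun_power_apply: "(f ^ n) x = f x ^ n" for f :: "'t \<Rightarrow> 'k::monoid_mult"
  by (induction n) auto

lemma span_mult_left:
  fixes g :: "'t \<Rightarrow> 'k::field"
  assumes f: "f \<in> fs.span A" and A: "\<And>a. a \<in> A \<Longrightarrow> g * a \<in> fs.span C"
  shows "g * f \<in> fs.span C"
  using f
proof (induction rule: fs.span_induct_alt)
  case base
  show "g * 0 \<in> fs.span C" by (simp add: fs.span_zero)
next
  case (step c a f)
  have "g * (fscale c a + f) = fscale c (g * a) + g * f"
    by (simp add: fun_eq_iff algebra_simps)
  moreover have "fscale c (g * a) + g * f \<in> fs.span C"
    by (intro fs.span_add fs.span_scale A step)
  ultimately show "g * (fscale c a + f) \<in> fs.span C" by metis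
qed

lemma span_mult:
  fixes f :: "'t \<Rightarrow> 'k::field"
  assumes "f \<in> fs.span A" "g \<in> fs.span B" "\<And>a b. a \<in> A \<Longrightarrow> b \<in> B \<Longrightarrow> a * b \<in> fs.span C"
  shows "f * g \<in> fs.span C"
proof (rule span_mult_left[OF assms(2)])
  fix b assume "b \<in> B"
  then have "b * f \<in> fs.span C" using assms(3) by (intro span_mult_left[OF assms(1)]) (simp add: mult.commute)
  then show "f * b \<in> fs.span C" by (simp add: mult.commute)
qed

lemma span_Union_chain:
  assumes "mono M" "f \<in> fs.span (\<Union>n. M n)"
  shows "\<exists>n::nat. f \<in> fs.span (M n)"
  using assms(2)
proof (induction rule: fs.span_induct_alt)
  case base
  show ?case using fs.span_zero by blast
next
  case (step c a f)
  then obtain n m where nm: "a \<in> M n" "f \<in> fs.span (M m)" by blast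
  have "a \<in> fs.span (M (max n m))" "f \<in> fs.span (M (max n m))"
    using nm fs.span_mono[OF monoD[OF assms(1), of m "max n m"]] monoD[OF assms(1), of n "max n m"]
    by (auto intro: fs.span_base)
  then show ?case by (blast intro: fs.span_add fs.span_scale)
qed

text \<open>Stated for families, whereas \<open>fs.dependent\<close> speaks of sets: if two members
  coincide, the set may be independent, and the relation is their difference.\<close>

lemma linear_relation:
  fixes f :: "nat \<Rightarrow> 't \<Rightarrow> 'k::field"
  assumes "finite G" "card G < K" "\<And>i. i < K \<Longrightarrow> f i \<in> fs.span G"
  shows "\<exists>c. (\<exists>i<K. c i \<noteq> 0) \<and> (\<forall>x. (\<Sum>i<K. c i * f i x) = 0)"
proof (cases "inj_on f {..<K}")
  case True
  let ?S = "f ` {..<K}"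
  have "fs.dependent ?S"
    using fs.independent_span_bound[OF assms(1), of ?S] assms(2,3) card_image[OF True]
    by (force simp: image_subset_iff)
  then obtain u where u: "\<exists>v\<in>?S. u v \<noteq> 0" "(\<Sum>v\<in>?S. fscale (u v) v) = 0"
    using fs.dependent_finite[of ?S] by auto
  have "(\<Sum>i<K. u (f i) * f i x) = 0" for x
  proof -
    have "(\<Sum>i<K. u (f i) * f i x) = (\<Sum>v\<in>?S. u v * v x)"
      by (simp add: sum.reindex[OF True])
    also have "\<dots> = (\<Sum>v\<in>?S. fscale (u v) v) x" by (simp add: fun_sum_apply)
    finally show ?thesis by (simp add: u(2))
  qed
  then show ?thesis using u(1) by (intro exI[of _ "\<lambda>i. u (f i)"]) auto
next
  case False
  then obtain i j where ij: "i < K" "j < K" "i \<noteq> j" "f i = f j" by (auto simp: inj_on_def)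
  define c :: "nat \<Rightarrow> 'k" where "c k = (if k = i then 1 else if k = j then - 1 else 0)" for k
  have "(\<Sum>k<K. c k * f k x) = 0" for x
  proof -
    have "(\<Sum>k<K. c k * f k x) = (\<Sum>k<K. (if k = i then f i x else 0) - (if k = j then f j x else 0))"
      using ij by (intro sum.cong) (auto simp: c_def)
    also have "\<dots> = 0" using ij by (simp add: sum_subtractf)
    finally show ?thesis .
  qed
  moreover have "c i \<noteq> 0" by (simp add: c_def)
  ultimately show ?thesis using ij by blast
qed

text \<open>Polynomials are represented by their functions. Over an infinite field this loses
  nothing, and the ring operations are the pointwise ones.\<close>

inductive_set polyfun :: "nat \<Rightarrow> ((nat \<Rightarrow> 'k::comm_ring_1) \<Rightarrow> 'k) set" for q where
  const: "(\<lambda>_. c) \<in> polyfun q"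
| var: "i < q \<Longrightarrow> (\<lambda>x. x i) \<in> polyfun q"
| add: "f \<in> polyfun q \<Longrightarrow> g \<in> polyfun q \<Longrightarrow> f + g \<in> polyfun q"
| mult: "f \<in> polyfun q \<Longrightarrow> g \<in> polyfun q \<Longrightarrow> f * g \<in> polyfun q"

lemma polyfun_subring: "subring_set (polyfun q)"
proof -
  have "f - g = f + (\<lambda>_. - 1) * g" for f g :: "(nat \<Rightarrow> 'a) \<Rightarrow> 'a" by (simp add: fun_eq_iff)
  then have "f - g \<in> polyfun q" if "f \<in> polyfun q" "g \<in> polyfun q" for f g :: "(nat \<Rightarrow> 'a) \<Rightarrow> 'a"
    using that polyfun.intros(1,3,4) by metis
  moreover have "1 = (\<lambda>_::nat \<Rightarrow> 'a. 1::'a)" by (simp add: fun_eq_iff)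
  ultimately show ?thesis unfolding subring_set_def using polyfun.intros(1,4) by metis
qed

lemmas polyfun_subringD = subring_setD[OF polyfun_subring]

lemma polyfun_poly: "f \<in> polyfun q \<Longrightarrow> (\<lambda>x. poly p (f x)) \<in> polyfun q"
proof (induction p)
  case 0
  then show ?case using polyfun.const[of 0] by simp
next
  case (pCons a p)
  have "(\<lambda>x. poly (pCons a p) (f x)) = (\<lambda>_. a) + f * (\<lambda>x. poly p (f x))"
    by (simp add: fun_eq_iff)
  then show ?case using pCons by (simp add: polyfun.const polyfun.add polyfun.mult)
qed

definition ymon :: "(nat \<Rightarrow> 'r::comm_ring_1) \<Rightarrow> nat \<Rightarrow> (nat \<Rightarrow> nat) \<Rightarrow> 'r" where
  "ymon y q a = (\<Prod>i<q. y i ^ a i)"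

lemma ymon_add: "ymon y q a * ymon y q b = ymon y q (\<lambda>i. a i + b i)"
  by (simp add: ymon_def power_add prod.distrib)

lemma ymon_Suc: "i < q \<Longrightarrow> y i * ymon y q a = ymon y q (a(i := Suc (a i)))"
proof -
  assume i: "i < q"
  have "ymon y q b = y i ^ b i * (\<Prod>j\<in>{..<q} - {i}. y j ^ b j)" for b
    unfolding ymon_def using i by (intro prod.remove) auto
  note this[of a] this[of "a(i := Suc (a i))"]
  moreover have "(\<Prod>j\<in>{..<q} - {i}. y j ^ (a(i := Suc (a i))) j) = (\<Prod>j\<in>{..<q} - {i}. y j ^ a j)"
    by (intro prod.cong) auto
  ultimately show ?thesis by (simp add: mult_ac)
qed

lemma ymon_sum_Suc: "i < q \<Longrightarrow> (\<Sum>j<q. (a(i := Suc (a i))) j) = Suc (\<Sum>j<q. a j)" for a :: "nat \<Rightarrow> nat"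
proof -
  assume i: "i < q"
  have "(\<Sum>j<q. b j) = b i + (\<Sum>j\<in>{..<q} - {i}. b j)" for b :: "nat \<Rightarrow> nat"
    using i by (intro sum.remove) auto
  note this[of a] this[of "a(i := Suc (a i))"]
  moreover have "(\<Sum>j\<in>{..<q} - {i}. (a(i := Suc (a i))) j) = (\<Sum>j\<in>{..<q} - {i}. a j)"
    by (intro sum.cong) auto
  ultimately show ?thesis by simp
qed

lemma ymon_polyfun: "(\<And>i. i < q \<Longrightarrow> y i \<in> polyfun p) \<Longrightarrow> ymon y q a \<in> polyfun p"
  unfolding ymon_def by (intro subring_set_prod polyfun_subring polyfun_subringD(7)) auto

text \<open>Over a finite field the product of all \<open>X - a\<close>, increased by 1, would be a
  nonconstant polynomial with value 1 everywhere.\<close>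

lemma infinite_alg_closed_field: "infinite (UNIV :: 'k::alg_closed_field set)"
proof
  assume fin: "finite (UNIV :: 'k set)"
  define p :: "'k poly" where "p = (\<Prod>a\<in>UNIV. [:- a, 1:])"
  have "degree p = card (UNIV :: 'k set)"
    unfolding p_def by (subst degree_prod_eq_sum_degree) (auto simp: fin)
  then have "degree (p + 1) > 0"
    using fin by (subst degree_add_eq_left) (auto simp: card_gt_0_iff)
  then obtain x where "poly (p + 1) x = 0" using alg_closed_imp_poly_has_root by blast
  moreover have "poly p x = 0" unfolding p_def poly_prod using fin by (subst prod_zero_iff) auto
  ultimately show False by simp
qed

text \<open>Base \<open>D\<close> digits number the exponent vectors in \<open>q\<close> variables
  with entries below \<open>D\<close> by the integers below \<open>D ^ q\<close>.\<close>

lemma digit_sum: "(\<Sum>i<q. (N div D ^ i) mod D * D ^ i) = N mod D ^ q" for N :: nat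
proof (induction q)
  case (Suc q)
  have "N mod D ^ Suc q = N mod (D ^ q * D)" by (simp add: mult.commute)
  also have "\<dots> = D ^ q * (N div D ^ q mod D) + N mod D ^ q" by (rule mod_mult2_eq)
  finally show ?case using Suc by (simp add: mult.commute)
qed simp

text \<open>The substitution \<open>x\<^sub>i = t ^ (D ^ i)\<close> maps the monomials with all exponents below \<open>D\<close> to
  distinct powers of \<open>t\<close>.\<close>

lemma monomials_independent:
  fixes c :: "nat \<Rightarrow> 'k::alg_closed_field"
  assumes "\<And>x. (\<Sum>N<D ^ q. c N * (\<Prod>i<q. x i ^ ((N div D ^ i) mod D))) = 0" "N < D ^ q"
  shows "c N = 0"
proof -
  define p where "p = (\<Sum>N<D ^ q. monom (c N) N)"
  have "poly p t = 0" for t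
  proof -
    have "(\<Prod>i<q. (t ^ D ^ i) ^ ((N div D ^ i) mod D)) = t ^ N" if "N < D ^ q" for N
    proof -
      have "(\<Prod>i<q. (t ^ D ^ i) ^ ((N div D ^ i) mod D)) = t ^ (\<Sum>i<q. (N div D ^ i) mod D * D ^ i)"
        by (simp add: power_sum mult.commute flip: power_mult)
      then show ?thesis using that by (simp add: digit_sum)
    qed
    then have "poly p t = (\<Sum>N<D ^ q. c N * (\<Prod>i<q. (t ^ D ^ i) ^ ((N div D ^ i) mod D)))"
      by (simp add: p_def poly_sum poly_monom)
    then show ?thesis using assms(1) by simp
  qed
  then have "p = 0" using poly_roots_finite[of p] infinite_alg_closed_field[where ?'k = 'k] by auto
  moreover have "coeff p N = c N" using assms(2) by (simp add: p_def coeff_sum)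
  ultimately show ?thesis by simp
qed

text \<open>\<open>W\<close> generates the ring of polynomial functions as a module over the algebra
  of the \<open>y i\<close>, so the map with components \<open>y i\<close> is finite. The locale
  treats the fiber over 0; other fibers are reached by subtracting constants from the
  components.\<close>

locale finite_polynomial_map =
  fixes q :: nat and y :: "nat \<Rightarrow> (nat \<Rightarrow> 'k::alg_closed_field) \<Rightarrow> 'k" and W
  assumes q_pos: "q > 0"
    and y_polyfun: "\<And>i. i < q \<Longrightarrow> y i \<in> polyfun q"
    and W_fin: "finite W" and W_polyfun: "W \<subseteq> polyfun q"
    and W_gen: "polyfun q \<subseteq> fs.span {ymon y q a * w | a w. w \<in> W}"
begin

section \<open>Growth of degrees with respect to the \<open>y i\<close>\<close>

definition gens :: "nat \<Rightarrow> ((nat \<Rightarrow> 'k) \<Rightarrow> 'k) set" where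
  "gens n = {ymon y q a * w | a w. w \<in> W \<and> (\<Sum>i<q. a i) \<le> n}"

definition yideal :: "((nat \<Rightarrow> 'k) \<Rightarrow> 'k) set" where
  "yideal = {\<Sum>i<q. y i * f i | f. \<forall>i. f i \<in> polyfun q}"

lemma mono_gens: "mono gens"
  unfolding gens_def by (intro monoI) force

lemma polyfun_gens:
  assumes "f \<in> polyfun q"
  shows "\<exists>n. f \<in> fs.span (gens n)"
proof (rule span_Union_chain[OF mono_gens])
  have "{ymon y q a * w | a w. w \<in> W} \<subseteq> (\<Union>n. gens n)" by (auto simp: gens_def)
  then show "f \<in> fs.span (\<Union>n. gens n)" using W_gen assms fs.span_mono by blast
qed

lemma finite_polyfun_gens:
  assumes "finite F" "F \<subseteq> polyfun q"
  shows "\<exists>n. F \<subseteq> fs.span (gens n)"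
  using assms
proof (induction F rule: finite_induct)
  case (insert f F)
  then obtain n where n: "F \<subseteq> fs.span (gens n)" by blast
  obtain m where "f \<in> fs.span (gens m)" using polyfun_gens[of f] insert.prems by blast
  with n have "insert f F \<subseteq> fs.span (gens (max n m))"
    using fs.span_mono[OF monoD[OF mono_gens, of n "max n m"]]
      fs.span_mono[OF monoD[OF mono_gens, of m "max n m"]] by auto
  then show ?case by blast
qed blast

text \<open>Multiplication by \<open>g\<close> commutes with the monomials in \<open>y\<close>, so
  its effect on the degree in \<open>y\<close> is controlled by the finitely many products
  \<open>g * w\<close>.\<close>

lemma gens_mult:
  assumes "f \<in> fs.span (gens n)" "\<And>w. w \<in> W \<Longrightarrow> g * w \<in> fs.span (gens C)"
  shows "g * f \<in> fs.span (gens (n + C))"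
proof (rule span_mult_left[OF assms(1)])
  fix a assume "a \<in> gens n"
  then obtain b w where b: "a = ymon y q b * w" "w \<in> W" "(\<Sum>i<q. b i) \<le> n" by (auto simp: gens_def)
  have "ymon y q b * (g * w) \<in> fs.span (gens (n + C))"
  proof (rule span_mult_left[OF assms(2)[OF b(2)]])
    fix a' assume "a' \<in> gens C"
    then obtain b' w' where b': "a' = ymon y q b' * w'" "w' \<in> W" "(\<Sum>i<q. b' i) \<le> C"
      by (auto simp: gens_def)
    have "ymon y q b * a' = ymon y q (\<lambda>i. b i + b' i) * w'"
      by (simp add: b' mult.assoc flip: ymon_add)
    moreover have "(\<Sum>i<q. b i + b' i) \<le> n + C" using b b' by (simp add: sum.distrib)
    ultimately show "ymon y q b * a' \<in> fs.span (gens (n + C))"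
      using b' unfolding gens_def by (intro fs.span_base) blast
  qed
  then show "g * a \<in> fs.span (gens (n + C))" by (simp add: b mult.left_commute)
qed

text \<open>\<open>C\<close> bounds the degree in \<open>y\<close> that is needed for 1 and for
  every product of a coordinate and a generator. Each further coordinate factor costs at most
  \<open>C\<close>, so the degree in \<open>y\<close> grows at most linearly with the degree in the
  coordinates.\<close>

lemma monomials_gens:
  obtains C where "\<And>c. ymon (\<lambda>i x. x i) q c \<in> fs.span (gens (C + C * (\<Sum>i<q. c i)))"
proof -
  let ?F = "insert 1 {(\<lambda>x. x i) * w | i w. i < q \<and> w \<in> W}"
  have "?F = insert 1 ((\<lambda>(i, w). (\<lambda>x. x i) * w) ` ({..<q} \<times> W))" by auto
  then have "finite ?F" using W_fin by simp
  moreover have "?F \<subseteq> polyfun q"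
    using W_polyfun by (auto intro: polyfun.mult polyfun.var polyfun_subringD(1))
  ultimately obtain C where C: "?F \<subseteq> fs.span (gens C)" using finite_polyfun_gens by blast
  have pow: "(\<lambda>x. x i) ^ k * f \<in> fs.span (gens (n + C * k))" if "i < q" "f \<in> fs.span (gens n)" for i k f n
  proof (induction k)
    case (Suc k)
    have "(\<lambda>x. x i) * ((\<lambda>x. x i) ^ k * f) \<in> fs.span (gens (n + C * k + C))"
      using C that by (intro gens_mult[OF Suc]) auto
    moreover have "n + C * k + C = n + C * Suc k" by simp
    ultimately show "(\<lambda>x. x i) ^ Suc k * f \<in> fs.span (gens (n + C * Suc k))"
      by (simp only: power_Suc mult.assoc)
  next
    case 0
    show "(\<lambda>x. x i) ^ 0 * f \<in> fs.span (gens (n + C * 0))" using that by simp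
  qed
  have "(\<Prod>i<p. (\<lambda>x. x i) ^ c i) \<in> fs.span (gens (C + C * (\<Sum>i<p. c i)))" if "p \<le> q" for p c
    using that
  proof (induction p)
    case 0
    show "(\<Prod>i<0. (\<lambda>x. x i) ^ c i) \<in> fs.span (gens (C + C * (\<Sum>i<0. c i)))" using C by simp
  next
    case (Suc p)
    then have "p < q" "p \<le> q" by simp_all
    then have "(\<lambda>x. x p) ^ c p * (\<Prod>i<p. (\<lambda>x. x i) ^ c i)
        \<in> fs.span (gens (C + C * (\<Sum>i<p. c i) + C * c p))"
      by (intro pow Suc.IH)
    moreover have "C + C * (\<Sum>i<p. c i) + C * c p = C + C * (\<Sum>i<Suc p. c i)"
      by (simp add: algebra_simps)
    ultimately show "(\<Prod>i<Suc p. (\<lambda>x. x i) ^ c i) \<in> fs.span (gens (C + C * (\<Sum>i<Suc p. c i)))"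
      by (simp only: prod.lessThan_Suc mult.commute)
  qed
  then show ?thesis using that[of C] by (simp add: ymon_def)
qed

text \<open>An exponent vector is determined by its first \<open>q - 1\<close> entries and the
  defect of its sum from \<open>n\<close>, which takes fewer than \<open>E + 1\<close> values; hence
  the power \<open>q - 1\<close> instead of \<open>q\<close>.\<close>

lemma card_top_gens:
  "finite {ymon y q a * w | a w. w \<in> W \<and> (\<Sum>i<q. a i) \<le> n \<and> n < (\<Sum>i<q. a i) + E}" (is "finite ?G")
  "card {ymon y q a * w | a w. w \<in> W \<and> (\<Sum>i<q. a i) \<le> n \<and> n < (\<Sum>i<q. a i) + E}
     \<le> card W * (E * (n + 1) ^ (q - 1))"
proof -
  define A where "A = {a \<in> {..<q} \<rightarrow>\<^sub>E {..n}. (\<Sum>i<q. a i) \<le> n \<and> n < (\<Sum>i<q. a i) + E}"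
  have finA: "finite A" unfolding A_def
    by (rule finite_subset[of _ "{..<q} \<rightarrow>\<^sub>E {..n}"]) (auto intro: finite_PiE)
  have sub: "?G \<subseteq> (\<lambda>(w, a). ymon y q a * w) ` (W \<times> A)"
  proof
    fix g assume "g \<in> ?G"
    then obtain a w where a: "g = ymon y q a * w" "w \<in> W" "(\<Sum>i<q. a i) \<le> n" "n < (\<Sum>i<q. a i) + E"
      by blast
    have "a i \<le> n" if "i < q" for i
      using member_le_sum[of i "{..<q}" a] that a(3) by simp
    then have "restrict a {..<q} \<in> A" using a by (auto simp: A_def)
    moreover have "ymon y q (restrict a {..<q}) = ymon y q a" by (simp add: ymon_def)
    ultimately show "g \<in> (\<lambda>(w, a). ymon y q a * w) ` (W \<times> A)" using a(1,2) by (intro image_eqI[of _ _ "(w, restrict a {..<q})"]) auto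
  qed
  show "finite ?G" by (rule finite_subset[OF sub]) (use W_fin finA in simp)
  have "card ?G \<le> card (W \<times> A)"
    by (rule order_trans[OF card_mono[OF _ sub] card_image_le]) (use W_fin finA in simp)+
  moreover have "card A \<le> E * (n + 1) ^ (q - 1)"
  proof -
    let ?h = "\<lambda>a. (n - (\<Sum>i<q. a i), restrict a {..<q - 1})"
    have q: "{..<q} = insert (q - 1) {..<q - 1}" using q_pos by auto
    have s: "(\<Sum>i<q. a i) = a (q - 1) + (\<Sum>i<q - 1. a i)" for a :: "nat \<Rightarrow> nat"
      unfolding q by simp
    have "inj_on ?h A"
    proof (rule inj_onI)
      fix a b assume ab: "a \<in> A" "b \<in> A" "?h a = ?h b"
      then have "restrict a {..<q - 1} = restrict b {..<q - 1}" by (simp only: prod.inject)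
      then have r: "a i = b i" if "i < q - 1" for i
        using that by (metis lessThan_iff restrict_apply')
      moreover have "(\<Sum>i<q. a i) = (\<Sum>i<q. b i)"
      proof -
        have "(\<Sum>i<q. a i) \<le> n" "(\<Sum>i<q. b i) \<le> n" using ab(1,2) unfolding A_def by blast+
        moreover have "n - (\<Sum>i<q. a i) = n - (\<Sum>i<q. b i)" using ab(3) by (simp only: prod.inject)
        ultimately show ?thesis by linarith
      qed
      moreover have "(\<Sum>i<q - 1. a i) = (\<Sum>i<q - 1. b i)" using r by simp
      ultimately have "a i = b i" if "i \<in> {..<q}" for i using that s[of a] s[of b] unfolding q by auto
      then show "a = b" using ab by (intro PiE_ext[of a "{..<q}" "\<lambda>_. {..n}" b]) (auto simp: A_def)
    qed
    moreover have "?h ` A \<subseteq> {..<E} \<times> ({..<q - 1} \<rightarrow>\<^sub>E {..n})"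
    proof (rule image_subsetI)
      fix a assume "a \<in> A"
      then have "\<forall>i<q. a i \<le> n" unfolding A_def by (simp add: PiE_iff)
      moreover have "n - (\<Sum>i<q. a i) < E"
        using \<open>a \<in> A\<close> unfolding A_def mem_Collect_eq by linarith
      ultimately show "?h a \<in> {..<E} \<times> ({..<q - 1} \<rightarrow>\<^sub>E {..n})"
        using q_pos by (simp add: restrict_PiE_iff)
    qed
    ultimately have "card A \<le> card ({..<E} \<times> ({..<q - 1} \<rightarrow>\<^sub>E {..n}))"
      by (rule card_inj_on_le) (intro finite_cartesian_product finite_PiE finite_lessThan finite_atMost)
    then show ?thesis by (simp add: card_cartesian_product card_PiE)
  qed
  ultimately show "card ?G \<le> card W * (E * (n + 1) ^ (q - 1))"
    unfolding card_cartesian_product by (meson mult_le_mono2 order_trans)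
qed

text \<open>If \<open>1\<close> were in the ideal, every generator could be pushed up to top degree in \<open>y\<close>, so the
  monomials of degree at most \<open>n\<close> would span a space of dimension only \<open>O(n ^ (q - 1))\<close>.\<close>

lemma one_notin_yideal: "1 \<notin> yideal"
proof
  assume "1 \<in> yideal"
  then obtain f where f: "1 = (\<Sum>i<q. y i * f i)" "\<And>i. f i \<in> polyfun q" by (auto simp: yideal_def)
  let ?F = "{f i * w | i w. i < q \<and> w \<in> W}"
  have "?F = (\<lambda>(i, w). f i * w) ` ({..<q} \<times> W)" by auto
  then have "finite ?F" using W_fin by simp
  moreover have "?F \<subseteq> polyfun q" using W_polyfun f(2) by (auto intro: polyfun.mult)
  ultimately obtain n0 where n0: "?F \<subseteq> fs.span (gens n0)" using finite_polyfun_gens by blast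
  \<comment> \<open>Each \<open>f i * w\<close> needs degree at most \<open>n0\<close> in
    \<open>y\<close>, and the factor \<open>y i\<close> adds one.\<close>
  define E where "E = Suc n0"
  have push: "w \<in> fs.span {ymon y q b * w' | b w'. w' \<in> W \<and> 1 \<le> (\<Sum>i<q. b i) \<and> (\<Sum>i<q. b i) \<le> E}"
    (is "_ \<in> fs.span ?U") if "w \<in> W" for w
  proof -
    have "w = (\<Sum>i<q. y i * (f i * w))"
      using arg_cong[OF f(1), of "\<lambda>u. u * w"] by (simp add: sum_distrib_right mult.assoc)
    also have "\<dots> \<in> fs.span ?U"
    proof (rule fs.span_sum)
      fix i assume i: "i \<in> {..<q}"
      then have "f i * w \<in> fs.span (gens n0)" using n0 that by blast
      then show "y i * (f i * w) \<in> fs.span ?U"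
      proof (rule span_mult_left)
        fix a assume "a \<in> gens n0"
        then obtain b w' where b: "a = ymon y q b * w'" "w' \<in> W" "(\<Sum>i<q. b i) \<le> n0"
          by (auto simp: gens_def)
        let ?b = "b(i := Suc (b i))"
        have "y i * a = ymon y q ?b * w'" using i by (simp add: b(1) ymon_Suc flip: mult.assoc)
        moreover have "(\<Sum>i<q. ?b i) = Suc (\<Sum>i<q. b i)" using i by (intro ymon_sum_Suc) simp
        ultimately have "y i * a \<in> ?U" using b unfolding E_def by (intro CollectI exI[of _ ?b] exI[of _ w']) simp
        then show "y i * a \<in> fs.span ?U" by (rule fs.span_base)
      qed
    qed
    finally show ?thesis .
  qed
  define G where "G n = {ymon y q a * w | a w. w \<in> W \<and> (\<Sum>i<q. a i) \<le> n \<and> n < (\<Sum>i<q. a i) + E}" for n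
  \<comment> \<open>A term of degree at most \<open>n - E\<close> is replaced by terms whose degree
    is higher by 1 to \<open>E\<close>. None of them exceeds \<open>n\<close>, and the process ends
    in the top \<open>E\<close> degrees.\<close>
  have up: "ymon y q a * w \<in> fs.span (G n)" if "w \<in> W" "(\<Sum>i<q. a i) \<le> n" for a w n
    using that
  proof (induction "n - (\<Sum>i<q. a i)" arbitrary: a w rule: less_induct)
    case less
    show ?case
    proof (cases "n < (\<Sum>i<q. a i) + E")
      case True
      then show ?thesis using less.prems unfolding G_def by (intro fs.span_base) blast
    next
      case False
      show ?thesis
      proof (rule span_mult_left[OF push[OF less.prems(1)]])
        fix u assume "u \<in> {ymon y q b * w' | b w'. w' \<in> W \<and> 1 \<le> (\<Sum>i<q. b i) \<and> (\<Sum>i<q. b i) \<le> E}"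
        then obtain b w' where b: "u = ymon y q b * w'" "w' \<in> W" "1 \<le> (\<Sum>i<q. b i)" "(\<Sum>i<q. b i) \<le> E"
          by blast
        have s: "(\<Sum>i<q. a i + b i) = (\<Sum>i<q. a i) + (\<Sum>i<q. b i)" by (rule sum.distrib)
        have "ymon y q (\<lambda>i. a i + b i) * w' \<in> fs.span (G n)"
          using less.prems b False by (intro less.hyps) (auto simp: s)
        then show "ymon y q a * u \<in> fs.span (G n)" by (simp add: b(1) mult.assoc flip: ymon_add)
      qed
    qed
  qed
  then have gG: "fs.span (gens n) \<subseteq> fs.span (G n)" for n
    by (intro fs.span_minimal fs.subspace_span) (auto simp: gens_def)
  obtain C where C: "\<And>c. ymon (\<lambda>i x. x i) q c \<in> fs.span (gens (C + C * (\<Sum>i<q. c i)))"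
    using monomials_gens by blast
  \<comment> \<open>The monomials with exponents below \<open>D\<close> are \<open>D ^ q\<close>
    independent functions of total degree at most \<open>q * D\<close>, so they all lie in the span
    of \<open>G n\<close> for \<open>n = C + C * (q * D)\<close>.\<close>
  have bound: "D ^ q \<le> card W * (E * (C + C * (q * D) + 1) ^ (q - 1))" if "D > 0" for D
  proof (rule ccontr)
    assume neg: "\<not> ?thesis"
    let ?n = "C + C * (q * D)"
    define c where "c N i = (N div D ^ i) mod D" for N i :: nat
    have span: "ymon (\<lambda>i x. x i) q (c N) \<in> fs.span (G ?n)" for N
    proof -
      have "c N i \<le> D" for i using that by (simp add: c_def less_imp_le)
      then have "(\<Sum>i<q. c N i) \<le> q * D" using sum_bounded_above[of "{..<q}" "c N" D] by simp
      then have "gens (C + C * (\<Sum>i<q. c N i)) \<subseteq> gens ?n" by (intro monoD[OF mono_gens]) simp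
      then show ?thesis using C[of "c N"] gG fs.span_mono by blast
    qed
    have fin: "finite (G ?n)" unfolding G_def by (rule card_top_gens(1))
    have card: "card (G ?n) < D ^ q"
      using neg card_top_gens(2)[where n = ?n and E = E] unfolding G_def by linarith
    have "\<exists>u. (\<exists>N<D ^ q. u N \<noteq> 0) \<and> (\<forall>x :: nat \<Rightarrow> 'k. (\<Sum>N<D ^ q. u N * ymon (\<lambda>i x. x i) q (c N) x) = 0)"
      by (rule linear_relation[OF fin card, where f = "\<lambda>N. ymon (\<lambda>i x. x i) q (c N)"]) (rule span)
    then obtain u :: "nat \<Rightarrow> 'k" where u: "\<exists>N<D ^ q. u N \<noteq> 0"
      "\<And>x. (\<Sum>N<D ^ q. u N * ymon (\<lambda>i x. x i) q (c N) x) = 0"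
      by blast
    have "u N = 0" if "N < D ^ q" for N
      by (rule monomials_independent[OF _ that])
        (use u(2) in \<open>simp add: ymon_def c_def fun_prod_apply fun_power_apply\<close>)
    then show False using u(1) by blast
  qed
  \<comment> \<open>Since \<open>n + 1 \<le> L * D\<close>, the bound becomes
    \<open>D ^ q \<le> K * D ^ (q - 1)\<close> with \<open>K = card W * E * L ^ (q - 1)\<close>,
    which fails for \<open>D = Suc K\<close>.\<close>
  define L where "L = C + C * q + 1"
  define D where "D = Suc (card W * E * L ^ (q - 1))"
  have "C + C * (q * D) + 1 \<le> L * D" by (simp add: L_def D_def algebra_simps)
  then have "(C + C * (q * D) + 1) ^ (q - 1) \<le> (L * D) ^ (q - 1)" by (rule power_mono) simp
  then have "card W * (E * (C + C * (q * D) + 1) ^ (q - 1)) \<le> card W * (E * (L * D) ^ (q - 1))"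
    by simp
  moreover have "D > 0" by (simp add: D_def)
  ultimately have "D ^ q \<le> card W * (E * (L * D) ^ (q - 1))"
    using order_trans[OF bound] by blast
  also have "\<dots> = (card W * E * L ^ (q - 1)) * D ^ (q - 1)" by (simp add: power_mult_distrib)
  finally have "D * D ^ (q - 1) \<le> (card W * E * L ^ (q - 1)) * D ^ (q - 1)"
    using q_pos by (cases q) auto
  then have "D \<le> card W * E * L ^ (q - 1)" by (simp add: D_def del: mult_Suc)
  then show False by (simp add: D_def)
qed

section \<open>The quotient by the ideal of the \<open>y i\<close> and its points\<close>

lemma yideal_ideal: "ideal_set (polyfun q) yideal"
  unfolding ideal_set_def
proof (intro conjI ballI)
  show "yideal \<subseteq> polyfun q"
    by (auto simp: yideal_def intro!: subring_set_sum polyfun_subring polyfun.mult y_polyfun)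
  show "0 \<in> yideal"
    unfolding yideal_def by (rule CollectI, rule exI[of _ "\<lambda>_. 0"]) (simp add: polyfun_subringD(2))
  show "a + b \<in> yideal" if "a \<in> yideal" "b \<in> yideal" for a b
  proof -
    obtain f g where fg: "a = (\<Sum>i<q. y i * f i)" "b = (\<Sum>i<q. y i * g i)"
      "\<forall>i. f i \<in> polyfun q" "\<forall>i. g i \<in> polyfun q"
      using \<open>a \<in> yideal\<close> \<open>b \<in> yideal\<close> by (auto simp: yideal_def)
    have "a + b = (\<Sum>i<q. y i * (f i + g i))" by (simp add: fg sum.distrib distrib_left)
    then show ?thesis using fg unfolding yideal_def
      by (intro CollectI exI[of _ "\<lambda>i. f i + g i"]) (simp add: polyfun.add)
  qed
  show "s * a \<in> yideal" if "s \<in> polyfun q" "a \<in> yideal" for s a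
  proof -
    obtain f where f: "a = (\<Sum>i<q. y i * f i)" "\<forall>i. f i \<in> polyfun q"
      using \<open>a \<in> yideal\<close> by (auto simp: yideal_def)
    have "s * a = (\<Sum>i<q. y i * (s * f i))" by (simp add: f sum_distrib_left mult_ac)
    then show ?thesis using f that unfolding yideal_def
      by (intro CollectI exI[of _ "\<lambda>i. s * f i"]) (simp add: polyfun.mult)
  qed
qed

lemma y_mult_yideal:
  assumes "i < q" "f \<in> polyfun q"
  shows "y i * f \<in> yideal"
proof -
  have "y i * f = (\<Sum>j<q. y j * (if j = i then f else 0))"
    using assms(1) by (simp add: if_distrib[of "\<lambda>u. y _ * u"] sum.delta cong: if_cong)
  then show ?thesis using assms(2) unfolding yideal_def
    by (intro CollectI exI[of _ "\<lambda>j. if j = i then f else 0"]) (simp add: polyfun_subringD(2))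
qed

text \<open>A generator with a positive exponent of some \<open>y i\<close> lies in
  \<open>yideal\<close>, so only \<open>W\<close> survives and the quotient ring has finite
  dimension.\<close>

lemma polyfun_mod_yideal:
  assumes "f \<in> polyfun q"
  shows "\<exists>w\<in>fs.span W. f - w \<in> yideal"
proof -
  have "f \<in> fs.span {ymon y q a * w | a w. w \<in> W}" using assms W_gen by blast
  then show ?thesis
  proof (induction rule: fs.span_induct_alt)
    case base
    have "0 - 0 \<in> yideal" using ideal_setD(1)[OF yideal_ideal] by simp
    then show "\<exists>w\<in>fs.span W. 0 - w \<in> yideal" using fs.span_zero by blast
  next
    case (step c g f)
    then obtain a w where aw: "g = ymon y q a * w" "w \<in> W" by blast
    have "\<exists>v\<in>fs.span W. g - v \<in> yideal"
    proof (cases "\<forall>i<q. a i = 0")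
      case True
      then have "g = w" by (simp add: aw ymon_def)
      then show ?thesis using aw(2) ideal_setD(1)[OF yideal_ideal] fs.span_base by force
    next
      case False
      then obtain i where i: "i < q" "a i \<noteq> 0" by blast
      let ?a = "a(i := a i - 1)"
      have "?a(i := Suc (?a i)) = a" using i by (auto simp: fun_eq_iff)
      then have "g = y i * (ymon y q ?a * w)"
        using ymon_Suc[OF i(1), of y ?a] by (simp add: aw flip: mult.assoc)
      moreover have "ymon y q ?a * w \<in> polyfun q"
        using aw(2) W_polyfun by (intro polyfun.mult ymon_polyfun y_polyfun) auto
      ultimately have "g - 0 \<in> yideal" using y_mult_yideal[OF i(1)] by simp
      then show ?thesis using fs.span_zero by blast
    qed
    then obtain v where v: "v \<in> fs.span W" "g - v \<in> yideal" by blast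
    obtain u where u: "u \<in> fs.span W" "f - u \<in> yideal" using step by blast
    have "(fscale c g + f) - (fscale c v + u) = (\<lambda>_. c) * (g - v) + (f - u)"
      by (simp add: fun_eq_iff algebra_simps)
    moreover have "\<dots> \<in> yideal"
      by (intro ideal_setD(3,4)[OF yideal_ideal] v u polyfun.const)
    ultimately have "fscale c g + f - (fscale c v + u) \<in> yideal" by metis
    moreover have "fscale c v + u \<in> fs.span W" by (intro fs.span_add fs.span_scale v u)
    ultimately show "\<exists>w\<in>fs.span W. fscale c g + f - w \<in> yideal" by blast
  qed
qed

text \<open>The quotient is spanned by \<open>card W\<close> elements, so \<open>card W + 1\<close>
  successive powers of \<open>f\<close> are linearly dependent in it.\<close>

lemma algebraic_mod_yideal:
  assumes f: "f \<in> polyfun q"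
  obtains p where "p \<noteq> 0" "(\<lambda>x. poly p (f x)) \<in> yideal"
proof -
  have "\<forall>n. \<exists>w\<in>fs.span W. f ^ n - w \<in> yideal"
    using polyfun_mod_yideal polyfun_subringD(7)[OF f] by blast
  then obtain w where w: "\<And>n. w n \<in> fs.span W" "\<And>n. f ^ n - w n \<in> yideal" by metis
  have "\<exists>c. (\<exists>n<Suc (card W). c n \<noteq> 0) \<and> (\<forall>x. (\<Sum>n<Suc (card W). c n * w n x) = 0)"
    by (rule linear_relation[OF W_fin]) (use w in simp_all)
  then obtain c where c: "\<exists>n<Suc (card W). c n \<noteq> 0" "\<And>x. (\<Sum>n<Suc (card W). c n * w n x) = 0"
    by blast
  define p where "p = (\<Sum>n<Suc (card W). monom (c n) n)"
  obtain n where n: "n < Suc (card W)" "c n \<noteq> 0" using c(1) by blast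
  have "coeff p n = c n" using n(1) unfolding p_def coeff_sum by (simp add: sum.delta del: sum.lessThan_Suc)
  then have "p \<noteq> 0" using n(2) by auto
  moreover have "(\<lambda>x. poly p (f x)) = (\<Sum>n<Suc (card W). (\<lambda>_. c n) * (f ^ n - w n))"
  proof
    fix x
    have "poly p (f x) = (\<Sum>n<Suc (card W). c n * f x ^ n)"
      by (simp add: p_def poly_sum poly_monom del: sum.lessThan_Suc)
    also have "\<dots> = (\<Sum>n<Suc (card W). c n * f x ^ n) - (\<Sum>n<Suc (card W). c n * w n x)"
      unfolding c(2) by simp
    also have "\<dots> = (\<Sum>n<Suc (card W). c n * (f x ^ n - w n x))"
      unfolding sum_subtractf[symmetric] by (simp only: right_diff_distrib)
    finally show "poly p (f x) = (\<Sum>n<Suc (card W). (\<lambda>_. c n) * (f ^ n - w n)) x"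
      by (simp add: fun_sum_apply fun_power_apply del: sum.lessThan_Suc)
  qed
  moreover have "\<dots> \<in> yideal"
    by (intro ideal_set_sum[OF yideal_ideal] ideal_setD(4)[OF yideal_ideal] polyfun.const w)
  ultimately show ?thesis using that by simp
qed

text \<open>Let \<open>J\<close> be a prime above \<open>yideal\<close>. Every \<open>f\<close> is a
  root modulo \<open>J\<close> of a nonzero polynomial, which splits into linear factors, so
  primality makes \<open>f\<close> congruent to a constant. The constants congruent to the
  coordinates form a point, and evaluation there is reduction modulo \<open>J\<close>.\<close>

theorem common_zero: "\<exists>x\<in>affine_space {..<q}. \<forall>i<q. y i x = 0"
proof -
  have "(1 :: (nat \<Rightarrow> 'k) \<Rightarrow> 'k) ^ n \<notin> yideal" for n using one_notin_yideal by simp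
  then obtain J where J: "prime_set (polyfun q) J" "yideal \<subseteq> J"
    using prime_ideal_avoiding_powers[OF polyfun_subring yideal_ideal] by metis
  have iJ: "ideal_set (polyfun q) J" and J1: "1 \<notin> J" using J by (auto simp: prime_set_def)
  have const: "c = 0" if "(\<lambda>_. c) \<in> J" for c
  proof (rule ccontr)
    assume "c \<noteq> 0"
    then have "(\<lambda>_. inverse c) * (\<lambda>_. c) = (1 :: (nat \<Rightarrow> 'k) \<Rightarrow> 'k)" by (simp add: fun_eq_iff)
    then show False using ideal_setD(4)[OF iJ polyfun.const that, of "inverse c"] J1 by simp
  qed
  have root: "\<exists>l. f - (\<lambda>_. l) \<in> J" if f: "f \<in> polyfun q" for f
  proof -
    have "\<exists>l. f - (\<lambda>_. l) \<in> J" if "p \<noteq> 0" "(\<lambda>x. poly p (f x)) \<in> J" for p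
      using that
    proof (induction "degree p" arbitrary: p rule: less_induct)
      case less
      show ?case
      proof (cases "degree p = 0")
        case True
        then obtain c where "p = [:c:]" by (meson degree_eq_zeroE)
        then show ?thesis using const[of c] less.prems by auto
      next
        case False
        then obtain a where "poly p a = 0" using alg_closed_imp_poly_has_root[of p] by auto
        then obtain p' where p': "p = [:- a, 1:] * p'" by (auto simp: poly_eq_0_iff_dvd)
        then have "p' \<noteq> 0" using less.prems by auto
        then have "degree p' < degree p" unfolding p' by (subst degree_mult_eq) auto
        have "(\<lambda>x. poly p (f x)) = (f - (\<lambda>_. a)) * (\<lambda>x. poly p' (f x))"
          by (simp add: p' fun_eq_iff algebra_simps)
        moreover have "f - (\<lambda>_. a) \<in> polyfun q" "(\<lambda>x. poly p' (f x)) \<in> polyfun q"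
          using f by (auto intro: polyfun_subringD(3) polyfun.const polyfun_poly)
        ultimately have "f - (\<lambda>_. a) \<in> J \<or> (\<lambda>x. poly p' (f x)) \<in> J"
          using J(1) less.prems(2) unfolding prime_set_def by metis
        then show ?thesis using less.hyps[OF \<open>degree p' < degree p\<close> \<open>p' \<noteq> 0\<close>] by blast
      qed
    qed
    then show ?thesis using algebraic_mod_yideal[OF f] J(2) by blast
  qed
  have "\<forall>i. \<exists>l. i < q \<longrightarrow> (\<lambda>x. x i) - (\<lambda>_. l) \<in> J" using root polyfun.var by blast
  then obtain l where l: "\<And>i. i < q \<Longrightarrow> (\<lambda>x. x i) - (\<lambda>_. l i) \<in> J" by metis
  define z where "z = restrict l {..<q}"
  have cong: "f - (\<lambda>_. f z) \<in> J" if "f \<in> polyfun q" for f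
    using that
  proof (induction rule: polyfun.induct)
    case (const c)
    have "(\<lambda>_. c) - (\<lambda>_. c) = (0 :: (nat \<Rightarrow> 'k) \<Rightarrow> 'k)" by simp
    then show "(\<lambda>_. c) - (\<lambda>_. c) \<in> J" using ideal_setD(1)[OF iJ] by metis
  next
    case (var i)
    then have "z i = l i" by (simp add: z_def)
    then show "(\<lambda>x. x i) - (\<lambda>_. z i) \<in> J" using l[OF var] by metis
  next
    case (add f g)
    have "f + g - (\<lambda>_. (f + g) z) = (f - (\<lambda>_. f z)) + (g - (\<lambda>_. g z))" by (simp add: fun_eq_iff)
    then show "f + g - (\<lambda>_. (f + g) z) \<in> J" using add(3,4) ideal_setD(3)[OF iJ] by metis
  next
    case (mult f g)
    have "f * g - (\<lambda>_. (f * g) z) = f * (g - (\<lambda>_. g z)) + (\<lambda>_. g z) * (f - (\<lambda>_. f z))"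
      by (simp add: fun_eq_iff algebra_simps)
    also have "\<dots> \<in> J" by (intro ideal_setD(3,4)[OF iJ] polyfun.const mult)
    finally show "f * g - (\<lambda>_. (f * g) z) \<in> J" .
  qed
  have "y i z = 0" if i: "i < q" for i
  proof -
    have "y i \<in> J" using y_mult_yideal[OF i polyfun_subringD(1)] J(2) by auto
    then have "y i - (y i - (\<lambda>_. y i z)) \<in> J"
      using cong[OF y_polyfun[OF i]] by (rule ideal_set_diff[OF polyfun_subring iJ])
    then show ?thesis using const by simp
  qed
  then show ?thesis by (intro bexI[of _ z]) (auto simp: z_def affine_space_def)
qed

text \<open>The coordinates are algebraic modulo \<open>yideal\<close>, so each coordinate of a zero
  is a root of a fixed nonzero polynomial.\<close>

theorem finite_common_zeros: "finite {x \<in> affine_space {..<q}. \<forall>i<q. y i x = 0}" (is "finite ?Z")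
proof -
  have van: "f x = 0" if "f \<in> yideal" "x \<in> ?Z" for f x
    using that by (auto simp: yideal_def fun_sum_apply)
  have "\<forall>i. \<exists>p. i < q \<longrightarrow> p \<noteq> 0 \<and> (\<lambda>x. poly p (x i)) \<in> yideal"
    using algebraic_mod_yideal[OF polyfun.var] by metis
  then obtain p where p: "\<And>i. i < q \<Longrightarrow> p i \<noteq> 0" "\<And>i. i < q \<Longrightarrow> (\<lambda>x. poly (p i) (x i)) \<in> yideal"
    by metis
  have "?Z \<subseteq> {..<q} \<rightarrow>\<^sub>E (\<Union>i<q. {t. poly (p i) t = 0})"
    
  proof
    fix x assume x: "x \<in> ?Z"
    then have "poly (p i) (x i) = 0" if "i < q" for i using van[OF p(2)[OF that]] by simp
    then show "x \<in> {..<q} \<rightarrow>\<^sub>E (\<Union>i<q. {t. poly (p i) t = 0})"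
      using x by (auto simp: affine_space_def PiE_iff)
  qed
  then show ?thesis
  proof (rule finite_subset)
    show "finite ({..<q} \<rightarrow>\<^sub>E (\<Union>i<q. {t. poly (p i) t = 0}))"
      using p(1) by (intro finite_PiE finite_UN_I poly_roots_finite) auto
  qed
qed

end


section \<open>The block determinants\<close>

text \<open>The coefficients of \<open>R2\<close> lie in the base field and the points over its
  closure, so evaluation goes along a homomorphism of coefficients. Being a ring homomorphism, it
  commutes with determinants.\<close>

lemma meval_comm_ring_hom:
  fixes \<phi> :: "'c::comm_ring_1 \<Rightarrow> 'k::comm_ring_1" and x :: "'i \<Rightarrow> 'k"
  assumes "comm_ring_hom \<phi>"
  shows "comm_ring_hom (meval \<phi> x)"
proof -
  interpret comm_ring_hom \<phi> by fact
  have add: "meval \<phi> x (p + q) = meval \<phi> x p + meval \<phi> x q" for p q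
  proof -
    let ?M = "Poly_Mapping.keys p \<union> Poly_Mapping.keys q"
    have "Poly_Mapping.keys (p + q) \<subseteq> ?M" by (rule Poly_Mapping.keys_add)
    then show ?thesis
      by (simp add: meval_superset[of ?M] lookup_add hom_add algebra_simps sum.distrib)
  qed
  have zero: "meval \<phi> x 0 = 0" by (simp add: meval_def)
  have single: "meval \<phi> x (Poly_Mapping.single m a) = \<phi> a * mmonom x m" for m a
    by (simp add: meval_def)
  have sum: "meval \<phi> x (\<Sum>a\<in>A. f a) = (\<Sum>a\<in>A. meval \<phi> x (f a))"
    for A :: "('i \<Rightarrow>\<^sub>0 nat) set" and f
    by (induction A rule: infinite_finite_induct) (auto simp: add zero)
  have mult: "meval \<phi> x (p * q) = meval \<phi> x p * meval \<phi> x q" for p q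
  proof -
    have "p * q = (\<Sum>m\<in>Poly_Mapping.keys p. \<Sum>n\<in>Poly_Mapping.keys q.
            Poly_Mapping.single (m + n) (Poly_Mapping.lookup p m * Poly_Mapping.lookup q n))"
      by (subst (1) mpoly_as_sum[of p], subst (1) mpoly_as_sum[of q])
        (simp add: sum_product mult_single)
    then show ?thesis
      by (simp add: sum single mmonom_add hom_mult)
        (simp add: meval_def sum_product mult_ac)
  qed
  show ?thesis
  proof
    show "meval \<phi> x 1 = 1" by (simp add: meval_def mmonom_def)
  qed (simp_all add: add zero mult)
qed

lemma meval_mvar:
  assumes "comm_ring_hom \<phi>"
  shows "meval \<phi> x (mvar i) = x i"
proof -
  interpret comm_ring_hom \<phi> by fact
  show ?thesis by (simp add: meval_def mvar_def mmonom_def)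
qed

lemma to_ac_hom: "comm_ring_hom to_ac"
  by unfold_locales simp_all

definition block_mat :: "nat \<Rightarrow> nat set set \<Rightarrow> (nat \<Rightarrow> 'k::comm_ring_1) \<Rightarrow> 'k mat" where
  "block_mat w P \<alpha> = mat w w (\<lambda>(a, r).
     \<alpha> (fst (block_pairs P ! a)) ^ Suc r - \<alpha> (snd (block_pairs P ! a)) ^ Suc r)"

lemma block_mat_carrier: "block_mat w P \<alpha> \<in> carrier_mat w w"
  by (simp add: block_mat_def)

lemma meval_block_det:
  assumes "comm_ring_hom \<phi>"
  shows "meval \<phi> \<alpha> (block_det w P) = det (block_mat w P \<alpha>)"
proof -
  interpret h: comm_ring_hom "meval \<phi> \<alpha>" by (rule meval_comm_ring_hom[OF assms])
  have pow: "meval \<phi> \<alpha> (mvar i ^ n) = \<alpha> i ^ n" for i n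
    by (induction n) (simp_all add: h.hom_mult meval_mvar[OF assms])
  show ?thesis
    unfolding block_det_def h.hom_det[symmetric]
    by (intro arg_cong[of _ _ det] eq_matI)
      (simp_all add: block_mat_def h.hom_minus pow del: power_Suc)
qed

lemma meval_R2:
  assumes "comm_ring_hom \<phi>"
  shows "meval \<phi> \<alpha> (R2 d e) =
     (\<Prod>Q | partition_on {1..npoints d e} Q \<and> card Q = d - 1. det (block_mat e Q \<alpha>)) *
     (\<Prod>P | partition_on {1..npoints d e} P \<and> card P = d. det (block_mat (e - 1) P \<alpha>))"
proof -
  interpret h: comm_ring_hom "meval \<phi> \<alpha>" by (rule meval_comm_ring_hom[OF assms])
  have prod: "meval \<phi> \<alpha> (prod f A) = (\<Prod>a\<in>A. meval \<phi> \<alpha> (f a))" for f and A :: "nat set set set"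
    by (induction A rule: infinite_finite_induct) (simp_all add: h.hom_mult)
  show ?thesis unfolding R2_def h.hom_mult prod meval_block_det[OF assms] ..
qed

lemma det_solve:
  fixes A :: "'k::field mat"
  assumes A: "A \<in> carrier_mat w w" and "det A \<noteq> 0"
  obtains B where "\<And>r s. r < w \<Longrightarrow> s < w \<Longrightarrow>
    (\<Sum>a<w. B r a * A $$ (a, s)) = (if r = s then 1 else 0)"
proof -
  have "(\<Sum>a<w. (adj_mat A $$ (r, a) / det A) * A $$ (a, s)) = (if r = s then 1 else 0)"
    if "r < w" "s < w" for r s
  proof -
    have "(\<Sum>a<w. adj_mat A $$ (r, a) * A $$ (a, s)) = (adj_mat A * A) $$ (r, s)"
      using A adj_mat(1)[OF A] that by (simp add: scalar_prod_def atLeast0LessThan)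
    also have "\<dots> = det A * (if r = s then 1 else 0)"
      unfolding adj_mat(3)[OF A] using that by simp
    finally have "(\<Sum>a<w. adj_mat A $$ (r, a) * A $$ (a, s)) / det A = (if r = s then 1 else 0)"
      using assms(2) by simp
    then show ?thesis by (simp add: sum_divide_distrib)
  qed
  then show ?thesis by (rule that)
qed

text \<open>Cramer's rule modulo an ideal: the matrix is invertible over the field and acts through
  \<open>\<kappa>\<close>, so its inverse can be applied to relations in \<open>M\<close>.\<close>

lemma det_solve_ideal:
  fixes A :: "'k::field mat" and \<kappa> :: "'k \<Rightarrow> 'r::comm_ring_1"
  assumes M: "ideal_set S M" and \<kappa>: "comm_ring_hom \<kappa>" "\<And>c. \<kappa> c \<in> S"
    and A: "A \<in> carrier_mat w w" "det A \<noteq> 0"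
    and v: "\<And>a. a < w \<Longrightarrow> (\<Sum>r<w. \<kappa> (A $$ (a, r)) * v r) \<in> M"
    and "r < w"
  shows "v r \<in> M"
proof -
  interpret comm_ring_hom \<kappa> by fact
  obtain B where B: "\<And>r s. r < w \<Longrightarrow> s < w \<Longrightarrow> (\<Sum>a<w. B r a * A $$ (a, s)) = (if r = s then 1 else 0)"
    using det_solve[OF A] by metis
  have "(\<Sum>a<w. \<kappa> (B r a) * (\<Sum>s<w. \<kappa> (A $$ (a, s)) * v s)) =
      (\<Sum>s<w. (\<Sum>a<w. \<kappa> (B r a) * \<kappa> (A $$ (a, s))) * v s)"
    unfolding sum_distrib_left sum_distrib_right by (subst sum.swap) (simp add: mult_ac)
  also have "\<dots> = (\<Sum>s<w. \<kappa> (\<Sum>a<w. B r a * A $$ (a, s)) * v s)"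
    by (simp add: hom_sum hom_mult)
  also have "\<dots> = (\<Sum>s<w. if s = r then v s else 0)"
    using \<open>r < w\<close> by (intro sum.cong refl) (auto simp: B)
  also have "\<dots> = v r" using \<open>r < w\<close> by simp
  finally show ?thesis
    using v \<kappa>(2) by (metis (no_types, lifting) ideal_setD(4)[OF M] ideal_set_sum[OF M] lessThan_iff)
qed

section \<open>The pairs attached to a partition\<close>

lemma partition_on_block:
  assumes "finite U" "partition_on U P" "B \<in> P"
  shows "finite B" "B \<noteq> {}" "B \<subseteq> U"
proof -
  show "B \<noteq> {}" "B \<subseteq> U" using assms(2,3) by (auto simp: partition_on_def)
  then show "finite B" using assms(1) finite_subset by blast
qed

lemma partition_on_Min:
  assumes "finite U" "partition_on U P" "B \<in> P"
  shows "Min B \<in> B" "C \<in> P \<Longrightarrow> j \<in> B \<Longrightarrow> j \<in> C \<Longrightarrow> C = B" "\<Union>{C \<in> P. Min B \<in> C} = B"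
proof -
  show min: "Min B \<in> B" using partition_on_block[OF assms] by simp
  show eq: "C = B" if "C \<in> P" "j \<in> B" "j \<in> C" for C j
    using that assms(2,3) by (auto simp: partition_on_def disjoint_def)
  have "{C \<in> P. Min B \<in> C} = {B}" using min assms(3) eq by blast
  then show "\<Union>{C \<in> P. Min B \<in> C} = B" by simp
qed

lemma block_pairs_set:
  assumes "finite U" "partition_on U P"
  shows "set (block_pairs P) = {(Min B, j) | B j. B \<in> P \<and> j \<in> B \<and> j \<noteq> Min B}"
proof -
  note fin = finite_elements[OF assms] partition_on_block[OF assms]
  have "set (block_pairs P) = (\<Union>B\<in>P. Pair (Min B) ` (B - {Min B}))"
    unfolding block_pairs_def using fin by (simp add: partition_on_Min(3)[OF assms])
  then show ?thesis by auto
qed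

text \<open>Each block contributes all of its elements but one.\<close>

lemma length_block_pairs:
  assumes "finite U" "partition_on U P"
  shows "length (block_pairs P) = card U - card P"
proof -
  note fin = finite_elements[OF assms] partition_on_block[OF assms]
  note min = partition_on_Min(1)[OF assms] and blk = partition_on_Min(3)[OF assms]
  have inj: "inj_on Min P"
    by (intro inj_onI) (metis blk)
  have "length (block_pairs P) =
      sum_list (map (\<lambda>i. card (\<Union>{B \<in> P. i \<in> B} - {i})) (sorted_list_of_set (Min ` P)))"
    unfolding block_pairs_def by (simp add: length_concat comp_def)
  also have "\<dots> = (\<Sum>i\<in>Min ` P. card (\<Union>{B \<in> P. i \<in> B} - {i}))"
    using fin by (simp add: sum_list_distinct_conv_sum_set)
  also have "\<dots> = (\<Sum>B\<in>P. card (B - {Min B}))"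
    unfolding sum.reindex[OF inj] by (intro sum.cong) (auto simp: blk)
  also have "\<dots> = (\<Sum>B\<in>P. card B - 1)"
    using fin min by (intro sum.cong) simp_all
  also have "\<dots> = (\<Sum>B\<in>P. card B) - card P"
    using fin by (subst sum_subtractf_nat) (auto simp: Suc_le_eq card_gt_0_iff)
  also have "(\<Sum>B\<in>P. card B) = card (\<Union>P)"
    using assms(2) fin by (intro card_Union_disjoint[symmetric]) (auto simp: partition_on_def disjoint_def pairwise_def disjnt_def)
  also have "\<Union>P = U" using assms(2) by (simp add: partition_on_def)
  finally show ?thesis .
qed

text \<open>If the \<open>v r\<close> are the coefficients of a polynomial without constant term,
  the hypothesis says that its values at the \<open>\<alpha> i\<close> of one block agree modulo
  \<open>M\<close>; the determinant then forces the coefficients into \<open>M\<close>.\<close>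

lemma block_mat_ideal:
  fixes \<kappa> :: "'k::field \<Rightarrow> 'r::comm_ring_1"
  assumes M: "ideal_set S M" and \<kappa>: "comm_ring_hom \<kappa>" "\<And>c. \<kappa> c \<in> S"
    and P: "finite U" "partition_on U P" "card U = w + card P" "det (block_mat w P \<alpha>) \<noteq> 0"
    and v: "\<And>B i j. B \<in> P \<Longrightarrow> i \<in> B \<Longrightarrow> j \<in> B \<Longrightarrow> (\<Sum>r<w. \<kappa> (\<alpha> i ^ Suc r - \<alpha> j ^ Suc r) * v r) \<in> M"
    and "r < w"
  shows "v r \<in> M"
proof (rule det_solve_ideal[OF M \<kappa> block_mat_carrier P(4) _ \<open>r < w\<close>])
  fix a assume a: "a < w"
  obtain i j where ij: "block_pairs P ! a = (i, j)" by fastforce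
  have "a < length (block_pairs P)" using a P length_block_pairs[OF P(1,2)] by simp
  then have "(i, j) \<in> set (block_pairs P)" using ij by (metis nth_mem)
  then obtain B where B: "B \<in> P" "j \<in> B" "i = Min B" using block_pairs_set[OF P(1,2)] by auto
  have "i \<in> B" using B partition_on_Min(1)[OF P(1,2)] by simp
  then have "(\<Sum>r<w. \<kappa> (\<alpha> i ^ Suc r - \<alpha> j ^ Suc r) * v r) \<in> M" using v B by blast
  then show "(\<Sum>r<w. \<kappa> (block_mat w P \<alpha> $$ (a, r)) * v r) \<in> M"
    using a by (simp add: block_mat_def ij del: power_Suc)
qed

text \<open>Sending the block minima to \<open>0\<close> and the other points to distinct nonzero values leaves a
  matrix of Vandermonde type.\<close>

lemma det_block_mat_nonzero:
  assumes U: "finite U" "partition_on U P" "card U = w + card P"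
  shows "\<exists>\<alpha> \<in> affine_space U. det (block_mat w P (\<alpha> :: nat \<Rightarrow> 'k::alg_closed_field)) \<noteq> 0"
proof -
  have "infinite (UNIV - {0 :: 'k})" using infinite_alg_closed_field by simp
  then obtain f :: "nat \<Rightarrow> 'k" where f: "inj f" "range f \<subseteq> UNIV - {0}"
    using infinite_countable_subset by blast
  define \<alpha> where "\<alpha> = restrict (\<lambda>j. if j \<in> Min ` P then 0 else f j) U"
  let ?b = "block_pairs P"
  have len: "length ?b = w" using length_block_pairs[OF U(1,2)] U(3) by simp
  note fin = finite_elements[OF U(1,2)] partition_on_block[OF U(1,2)]
  have min: "Min B \<in> B" "Min B \<in> U" if "B \<in> P" for B
    using partition_on_Min(1)[OF U(1,2) that] fin(4)[OF that] by auto
  have nm: "j \<notin> Min ` P" if "B \<in> P" "j \<in> B" "j \<noteq> Min B" for B j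
  proof
    assume "j \<in> Min ` P"
    then obtain C where C: "C \<in> P" "j = Min C" by blast
    then have "j \<in> C" using min by simp
    then have "C = B" using that C partition_on_Min(2)[OF U(1,2)] by blast
    then show False using C that by simp
  qed
  have snd: "set (map snd ?b) = U - Min ` P"
  proof -
    have "snd ` {(Min B, j) | B j. B \<in> P \<and> j \<in> B \<and> j \<noteq> Min B} = {j. \<exists>B\<in>P. j \<in> B \<and> j \<noteq> Min B}"
      by (auto simp: image_iff)
    then have sb: "set (map snd ?b) = {j. \<exists>B\<in>P. j \<in> B \<and> j \<noteq> Min B}"
      by (simp only: set_map block_pairs_set[OF U(1,2)])
    show ?thesis
    proof (intro equalityI subsetI)
      fix j assume "j \<in> set (map snd ?b)"
      then obtain B where B: "B \<in> P" "j \<in> B" "j \<noteq> Min B" unfolding sb by blast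
      then show "j \<in> U - Min ` P" using nm[OF B] fin(4)[OF B(1)] by blast
    next
      fix j assume j: "j \<in> U - Min ` P"
      then obtain B where B: "B \<in> P" "j \<in> B" using partition_onD1[OF U(2)] by blast
      then have "j \<noteq> Min B" using j by blast
      then show "j \<in> set (map snd ?b)" unfolding sb using B by blast
    qed
  qed
  have "card (Min ` P) = card P"
  proof (rule card_image, rule inj_onI)
    fix B C assume "B \<in> P" "C \<in> P" "Min B = Min C"
    then show "B = C" using min(1) partition_on_Min(2)[OF U(1,2)] by metis
  qed
  then have "card (U - Min ` P) = w"
    using U min fin by (subst card_Diff_subset) auto
  then have dist: "distinct (map snd ?b)" using snd len by (intro card_distinct) simp
  have val: "\<alpha> (fst (?b ! a)) = 0" "\<alpha> (snd (?b ! a)) = f (snd (?b ! a))" if "a < w" for a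
  proof -
    have "?b ! a \<in> set ?b" using that len by simp
    then obtain B j where "?b ! a = (Min B, j)" "B \<in> P" "j \<in> B" "j \<noteq> Min B"
      using block_pairs_set[OF U(1,2)] by auto
    moreover have "j \<in> U" using calculation U(2) by (auto simp: partition_on_def)
    ultimately show "\<alpha> (fst (?b ! a)) = 0" "\<alpha> (snd (?b ! a)) = f (snd (?b ! a))"
      using min nm by (auto simp: \<alpha>_def)
  qed
  have "det (block_mat w P \<alpha>) \<noteq> 0"
  proof
    assume "det (block_mat w P \<alpha>) = 0"
    then obtain v where v: "v \<in> carrier_vec w" "v \<noteq> 0\<^sub>v w" "block_mat w P \<alpha> *\<^sub>v v = 0\<^sub>v w"
      using det_0_iff_vec_prod_zero_field[OF block_mat_carrier] by blast
    \<comment> \<open>A kernel vector gives a polynomial of degree at most \<open>w\<close> without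
      constant term. It vanishes at 0 and at \<open>w\<close> distinct nonzero values, one root too
      many.\<close>
    define p where "p = (\<Sum>r<w. monom (v $ r) (Suc r))"
    let ?R = "insert 0 ((\<lambda>a. f (snd (?b ! a))) ` {..<w})"
    have "poly p (f (snd (?b ! a))) = 0" if "a < w" for a
    proof -
      have "(block_mat w P \<alpha> *\<^sub>v v) $ a = 0" using v(3) that by simp
      then have "(\<Sum>r<w. - (f (snd (?b ! a)) ^ Suc r * (v $ r))) = 0"
        using that v(1) val[OF that]
        by (simp add: block_mat_def scalar_prod_def atLeast0LessThan)
      then have "- (\<Sum>r<w. f (snd (?b ! a)) ^ Suc r * (v $ r)) = 0"
        by (simp add: sum_negf)
      then show ?thesis by (simp add: p_def poly_sum poly_monom mult_ac)
    qed
    moreover have "poly p 0 = 0" by (simp add: p_def poly_sum poly_monom)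
    ultimately have roots: "?R \<subseteq> {t. poly p t = 0}" by auto
    have "inj_on (\<lambda>a. f (snd (?b ! a))) {..<w}"
    proof (rule inj_onI)
      fix a b assume ab: "a \<in> {..<w}" "b \<in> {..<w}" "f (snd (?b ! a)) = f (snd (?b ! b))"
      then have "map snd ?b ! a = map snd ?b ! b" using f(1) len by (simp add: inj_eq)
      then show "a = b"
        using nth_eq_iff_index_eq[OF dist, of a b] ab(1,2) len
        by (metis length_map lessThan_iff)
    qed
    moreover have "0 \<notin> (\<lambda>a. f (snd (?b ! a))) ` {..<w}" using f(2) by force
    ultimately have "card ?R = Suc w" by (simp add: card_image)
    moreover have "degree p \<le> w"
      unfolding p_def by (intro degree_sum_le) (auto intro: order_trans[OF degree_monom_le])
    ultimately have "p = 0"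
      using roots card_mono[OF poly_roots_finite roots] card_poly_roots_bound[of p] by force
    have "v $ r = 0" if "r < w" for r
    proof -
      have "coeff p (Suc r) = v $ r" using that by (simp add: p_def coeff_sum)
      then show ?thesis using \<open>p = 0\<close> by simp
    qed
    then have "v = 0\<^sub>v w" using v(1) by (intro eq_vecI) auto
    then show False using v(2) by simp
  qed
  moreover have "\<alpha> \<in> affine_space U" by (simp add: \<alpha>_def affine_space_def)
  ultimately show ?thesis by blast
qed


section \<open>Density of nonvanishing loci\<close>

text \<open>For density only restrictions to lines matter. This treats alike polynomials over the
  base field and over its closure, and in different sets of variables.\<close>

definition line_poly :: "(('i \<Rightarrow> 'k::comm_ring_1) \<Rightarrow> 'k) \<Rightarrow> bool" where
  "line_poly F \<longleftrightarrow> (\<forall>x z. \<exists>p. \<forall>t. F (\<lambda>i. x i + t * (z i - x i)) = poly p t)"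

lemma line_poly_const: "line_poly (\<lambda>_. c)"
  unfolding line_poly_def by (intro allI exI[of _ "[:c:]"]) simp

lemma line_poly_var: "line_poly (\<lambda>x. x i)"
  unfolding line_poly_def
proof (intro allI)
  fix x z :: "'a \<Rightarrow> 'b"
  show "\<exists>p. \<forall>t. x i + t * (z i - x i) = poly p t" by (intro exI[of _ "[:x i, z i - x i:]"]) simp
qed

lemma line_poly_add: "line_poly F \<Longrightarrow> line_poly G \<Longrightarrow> line_poly (\<lambda>x. F x + G x)"
  unfolding line_poly_def by (metis poly_add)

lemma line_poly_mult: "line_poly F \<Longrightarrow> line_poly G \<Longrightarrow> line_poly (\<lambda>x. F x * G x)"
  unfolding line_poly_def by (metis poly_mult)

lemma line_poly_power: "line_poly F \<Longrightarrow> line_poly (\<lambda>x. F x ^ n)"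
  by (induction n) (auto intro: line_poly_const line_poly_mult)

lemma line_poly_sum: "(\<And>a. a \<in> A \<Longrightarrow> line_poly (F a)) \<Longrightarrow> line_poly (\<lambda>x. \<Sum>a\<in>A. F a x)"
  by (induction A rule: infinite_finite_induct) (auto intro: line_poly_const line_poly_add)

lemma line_poly_prod: "(\<And>a. a \<in> A \<Longrightarrow> line_poly (F a)) \<Longrightarrow> line_poly (\<lambda>x. \<Prod>a\<in>A. F a x)"
  by (induction A rule: infinite_finite_induct) (auto intro: line_poly_const line_poly_mult)

lemma line_poly_meval: "line_poly (\<lambda>x. meval \<phi> x p)"
  unfolding meval_def mmonom_def
  by (intro line_poly_sum line_poly_mult line_poly_const line_poly_prod line_poly_power line_poly_var)

lemma line_poly_comp: "line_poly F \<Longrightarrow> line_poly (\<lambda>x. F (x \<circ> f))"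
  unfolding line_poly_def comp_def by (intro allI) (rule allE, assumption, rule allE, assumption)

text \<open>On the line from \<open>x\<close> to \<open>z\<close> the two functions are polynomials
  in \<open>t\<close> that are nonzero at 0 and at 1 respectively, so their product is a nonzero
  polynomial and has a nonroot.\<close>

lemma line_poly_both_nonzero:
  fixes F G :: "('i \<Rightarrow> 'k::alg_closed_field) \<Rightarrow> 'k"
  assumes "line_poly F" "line_poly G" and x: "x \<in> affine_space I" "F x \<noteq> 0"
    and z: "z \<in> affine_space I" "G z \<noteq> 0"
  obtains u where "u \<in> affine_space I" "F u \<noteq> 0" "G u \<noteq> 0"
proof -
  obtain p where p: "\<And>t. F (\<lambda>i. x i + t * (z i - x i)) = poly p t"
    using assms(1) unfolding line_poly_def by blast
  obtain r where r: "\<And>t. G (\<lambda>i. x i + t * (z i - x i)) = poly r t"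
    using assms(2) unfolding line_poly_def by blast
  have "poly p 0 \<noteq> 0" "poly r 1 \<noteq> 0" using p[of 0] r[of 1] x z by simp_all
  then have "p * r \<noteq> 0" by auto
  then obtain t where "poly (p * r) t \<noteq> 0"
    using poly_roots_finite[of "p * r"] infinite_alg_closed_field[where ?'k = 'k]
    by (metis (mono_tags, lifting) UNIV_eq_I mem_Collect_eq)
  \<comment> \<open>Outside \<open>I\<close> both ends have the value \<open>undefined\<close>, and
    so does every point of the line.\<close>
  moreover have "(\<lambda>i. x i + t * (z i - x i)) \<in> affine_space I"
    using x z by (auto simp: affine_space_def PiE_iff extensional_def)
  ultimately show ?thesis using that p r by simp
qed

lemma line_poly_prod_nonzero:
  fixes F :: "'s \<Rightarrow> ('i \<Rightarrow> 'k::alg_closed_field) \<Rightarrow> 'k"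
  assumes "finite A" "\<And>a. a \<in> A \<Longrightarrow> line_poly (F a)"
    "\<And>a. a \<in> A \<Longrightarrow> \<exists>x\<in>affine_space I. F a x \<noteq> 0"
  shows "\<exists>x\<in>affine_space I. (\<Prod>a\<in>A. F a x) \<noteq> 0"
  using assms
proof (induction A rule: finite_induct)
  case empty
  have "(\<lambda>i. if i \<in> I then 0 else undefined) \<in> affine_space I" by (auto simp: affine_space_def)
  then show ?case by auto
next
  case (insert a A)
  obtain x where x: "x \<in> affine_space I" "F a x \<noteq> 0" using insert.prems by blast
  obtain z where z: "z \<in> affine_space I" "(\<Prod>a\<in>A. F a z) \<noteq> 0" using insert by blast
  define G where "G = (\<lambda>x. \<Prod>a\<in>A. F a x)"
  have "line_poly (F a)" "line_poly G"
    unfolding G_def using insert.prems by (simp_all add: line_poly_prod)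
  moreover have "G z \<noteq> 0" using z by (simp add: G_def)
  ultimately obtain u where "u \<in> affine_space I" "F a u \<noteq> 0" "G u \<noteq> 0"
    using line_poly_both_nonzero[of "F a" G x I z] x z(1) by blast
  then have "u \<in> affine_space I" "F a u \<noteq> 0" "(\<Prod>a\<in>A. F a u) \<noteq> 0" by (simp_all add: G_def)
  then show ?case using insert.hyps by (intro bexI[of _ u]) simp_all
qed

text \<open>By \<open>det_block_mat_nonzero\<close> every determinant is nonzero somewhere; lines
  combine these points into a single one.\<close>

lemma R2_nonzero:
  assumes "d \<ge> 2" "e \<ge> 2"
  shows "\<exists>\<alpha>\<in>affine_space {1..npoints d e}.
    meval (to_ac :: 'a::field \<Rightarrow> 'a alg_closure) \<alpha> (R2 d e) \<noteq> 0"
proof -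
  let ?U = "{1..npoints d e}"
  have *: "\<exists>\<alpha>\<in>affine_space ?U. (\<Prod>P | partition_on ?U P \<and> card P = m.
      meval (to_ac :: 'a \<Rightarrow> 'a alg_closure) \<alpha> (block_det w P)) \<noteq> 0" if "m + w = d + e - 1" for m w
  proof (rule line_poly_prod_nonzero)
    show "finite {P. partition_on ?U P \<and> card P = m}"
      by (rule finite_subset[OF _ finitely_many_partition_on[of ?U]]) auto
    show "\<exists>\<alpha>\<in>affine_space ?U. meval (to_ac :: 'a \<Rightarrow> 'a alg_closure) \<alpha> (block_det w P) \<noteq> 0"
      if "P \<in> {P. partition_on ?U P \<and> card P = m}" for P
      using that det_block_mat_nonzero[of ?U P w] \<open>m + w = d + e - 1\<close>
      by (simp add: meval_block_det[OF to_ac_hom] npoints_def add.commute)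
  qed (rule line_poly_meval)
  define F where "F m w \<alpha> = (\<Prod>P | partition_on ?U P \<and> card P = m.
      meval (to_ac :: 'a \<Rightarrow> 'a alg_closure) \<alpha> (block_det w P))" for m w \<alpha>
  have lp: "line_poly (F m w)" for m w
    unfolding F_def by (intro line_poly_prod line_poly_meval)
  obtain x where x: "x \<in> affine_space ?U" "F (d - 1) e x \<noteq> 0"
    unfolding F_def using *[of "d - 1" e] assms by auto
  obtain z where z: "z \<in> affine_space ?U" "F d (e - 1) z \<noteq> 0"
    unfolding F_def using *[of d "e - 1"] assms by auto
  obtain u where "u \<in> affine_space ?U" "F (d - 1) e u \<noteq> 0" "F d (e - 1) u \<noteq> 0"
    using line_poly_both_nonzero[of "F (d - 1) e" "F d (e - 1)" x ?U z] lp x z by blast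
  then show ?thesis
    by (intro bexI[of _ u])
      (simp_all add: F_def meval_R2[OF to_ac_hom] meval_block_det[OF to_ac_hom])
qed


section \<open>Finite spaces and Zariski topologies\<close>

text \<open>Every subset is closed, so an irreducible closed set is a single point and chains have
  length 0. Nonemptiness excludes the value \<open>-\<infinity>\<close>.\<close>

lemma krull_dim_finite_T1:
  assumes fin: "finite (topspace T)" and ne: "topspace T \<noteq> {}"
    and T1: "\<And>x. x \<in> topspace T \<Longrightarrow> closedin T {x}"
  shows "krull_dim T = 0"
proof -
  have closed: "closedin T C" if "C \<subseteq> topspace T" for C
  proof -
    have "closedin T (\<Union>x\<in>C. {x})"
      using that fin by (intro closedin_Union) (auto intro: T1 finite_subset)
    then show ?thesis by simp
  qed
  have sing: "\<exists>p. C = {p}" if C: "closedin T C" "irreducible_space (subtopology T C)" for C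
  proof -
    have sub: "C \<subseteq> topspace T" using C(1) closedin_subset by blast
    then have top: "topspace (subtopology T C) = C" by auto
    then obtain p where p: "p \<in> C" using C(2) by (auto simp: irreducible_space_def)
    have cl: "closedin (subtopology T C) A" if "A \<subseteq> C" for A
      using closed[of A] that sub by (auto simp: closedin_subtopology)
    have "C = {p} \<or> C = C - {p}"
      using C(2) cl[of "{p}"] cl[of "C - {p}"] p unfolding irreducible_space_def top by blast
    then show ?thesis using p by blast
  qed
  obtain x where x: "x \<in> topspace T" using ne by blast
  have "{ereal (real n) | n. \<exists>Z. (\<forall>i\<le>n. closedin T (Z i) \<and> irreducible_space (subtopology T (Z i))) \<and>
         (\<forall>i<n. Z i \<subset> Z (Suc i))} = {0}" (is "?S = _")
  proof (intro equalityI subsetI)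
    fix r assume "r \<in> ?S"
    then obtain n Z where Z: "r = ereal (real n)"
      "\<And>i. i \<le> n \<Longrightarrow> closedin T (Z i) \<and> irreducible_space (subtopology T (Z i))"
      "\<And>i. i < n \<Longrightarrow> Z i \<subset> Z (Suc i)" by blast
    have "n = 0"
    proof (rule ccontr)
      assume "n \<noteq> 0"
      then have "Z 0 \<subset> Z 1" "\<exists>p. Z 0 = {p}" "\<exists>p. Z 1 = {p}" using Z(2,3)[of 0] Z(2)[of 1] sing by auto
      then show False by auto
    qed
    then show "r \<in> {0}" using Z by simp
  next
    fix r :: ereal assume "r \<in> {0}"
    have top: "topspace (subtopology T {x}) = {x}" using x by auto
    have "A = {x} \<or> B = {x}" if "{x} = A \<union> B" for A B using that by blast
    then have "irreducible_space (subtopology T {x})"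
      unfolding irreducible_space_def top by blast
    then have "\<exists>Z. (\<forall>i\<le>0::nat. closedin T (Z i) \<and> irreducible_space (subtopology T (Z i))) \<and>
         (\<forall>i<0. Z i \<subset> Z (Suc i))"
      using T1[OF x] by (intro exI[of _ "\<lambda>_. {x}"]) simp
    moreover have "r = ereal (real 0)" using \<open>r \<in> {0}\<close> by simp
    ultimately show "r \<in> ?S" by blast
  qed
  then show ?thesis by (simp add: krull_dim_def)
qed

lemma closedin_pullback_topology:
  assumes "closedin T C"
  shows "closedin (pullback_topology A f T) (f -` C \<inter> A)"
proof -
  have C: "C \<subseteq> topspace T" "openin T (topspace T - C)" using assms by (auto simp: closedin_def)
  have "f -` topspace T \<inter> A - (f -` C \<inter> A) = f -` (topspace T - C) \<inter> A" by blast
  then show ?thesis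
    using C unfolding closedin_def topspace_pullback_topology openin_pullback_topology by auto
qed

lemma closedin_zariski_point:
  fixes x :: "'i \<Rightarrow> 'k::idom"
  assumes x: "x \<in> affine_space I"
  shows "closedin (zariski I) {x}"
proof -
  have hom: "comm_ring_hom (\<lambda>c::'k. c)" by unfold_locales simp_all
  interpret h: comm_ring_hom "meval (\<lambda>c::'k. c) z" for z :: "'i \<Rightarrow> 'k"
    by (rule meval_comm_ring_hom[OF hom])
  define l :: "'i \<Rightarrow> ('i, 'k) mpoly" where "l i = mvar i - Poly_Mapping.single 0 (x i)" for i
  have ev: "meval (\<lambda>c. c) z (l i) = z i - x i" for z i
    by (simp add: l_def h.hom_minus meval_mvar[OF hom] meval_single mmonom_def)
  have "mvars (l i) \<subseteq> {i}" for i
  proof -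
    have "Poly_Mapping.keys (l i) \<subseteq> {Poly_Mapping.single i 1, 0}"
      using keys_diff[of "mvar i :: ('i, 'k) mpoly" "Poly_Mapping.single 0 (x i)"]
      by (auto simp: l_def mvar_def split: if_splits)
    then show ?thesis by (fastforce simp: mvars_def split: if_splits)
  qed
  then have "\<forall>p\<in>l ` I. mvars p \<subseteq> I" by blast
  moreover have "{x} = zero_locus I (l ` I)"
  proof -
    have "z = x" if "z \<in> affine_space I" "\<forall>i\<in>I. z i = x i" for z
      using that x by (auto simp: affine_space_def intro: PiE_ext)
    then show ?thesis using x by (auto simp: zero_locus_def ev)
  qed
  ultimately show ?thesis unfolding closedin_zariski by blast
qed


section \<open>The interpolation equations\<close>

text \<open>\<open>monom (\<eta> i) 1\<close> is the node placed in degree 1 of the Rees ring; each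
  factor of the product contributes one T.\<close>

lemma vand_monom: "vand (\<lambda>i. monom (\<eta> i) 1) n = monom (vand \<eta> n) (\<Sum>i<n. i)"
proof (induction n)
  case (Suc n)
  have "(\<Prod>i<k. monom (\<eta> n) 1 - monom (\<eta> i) 1) = monom (\<Prod>i<k. \<eta> n - \<eta> i) k" for k
    by (induction k) (simp_all add: diff_monom mult_monom one_pCons monom_0)
  then show ?case by (simp add: vand_Suc Suc mult_monom del: One_nat_def)
qed (simp add: vand_def one_pCons monom_0)

text \<open>The two families of determinants are the factors of \<open>R2\<close> at
  \<open>\<alpha>\<close>. The prescribed values \<open>\<beta>\<close> are arbitrary.\<close>

locale interpolation =
  fixes d e :: nat and \<alpha> \<beta> :: "nat \<Rightarrow> 'k::alg_closed_field"
  assumes d2: "d \<ge> 2" and e2: "e \<ge> 2"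
    and det_R: "\<And>P. partition_on {1..d + e - 1} P \<Longrightarrow> card P = d - 1 \<Longrightarrow> det (block_mat e P \<alpha>) \<noteq> 0"
    and det_S: "\<And>P. partition_on {1..d + e - 1} P \<Longrightarrow> card P = d \<Longrightarrow> det (block_mat (e - 1) P \<alpha>) \<noteq> 0"
begin

abbreviation q :: nat where "q \<equiv> d + e - 1"

text \<open>The coordinates \<open>0, \<dots>, d - 1\<close> are the coefficients of \<open>g\<close>, the coordinate \<open>d + r\<close> is the
  coefficient of \<open>X ^ (r + 1)\<close> in \<open>h\<close>; \<open>\<eta> i\<close> is \<open>h (\<alpha> i)\<close>.\<close>

definition hc :: "nat \<Rightarrow> (nat \<Rightarrow> 'k) \<Rightarrow> 'k" where "hc r = (\<lambda>x. x (d + r))"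

definition \<eta> :: "nat \<Rightarrow> (nat \<Rightarrow> 'k) \<Rightarrow> 'k" where
  "\<eta> i = (\<lambda>_. \<alpha> i ^ e) + (\<Sum>r<e - 1. (\<lambda>_. \<alpha> i ^ Suc r) * hc r)"

definition gp :: "((nat \<Rightarrow> 'k) \<Rightarrow> 'k) poly" where
  "gp = monom 1 d + (\<Sum>i<d. monom (\<lambda>x. x i) i)"

definition y :: "nat \<Rightarrow> (nat \<Rightarrow> 'k) \<Rightarrow> 'k" where
  "y k = poly gp (\<eta> (Suc k)) - (\<lambda>_. \<beta> (Suc k))"

text \<open>The degree counts only the coefficients of h: the \<open>y k\<close> have degree 0, and
  the coefficients of g enter only through them. That the filtration becomes stationary expresses
  integrality of the coefficients of h over the algebra of the \<open>y k\<close>.\<close>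

definition Q :: "nat \<Rightarrow> ((nat \<Rightarrow> 'k) \<Rightarrow> 'k) set" where
  "Q m = fs.span {ymon y q a * ymon hc (e - 1) c | a c. (\<Sum>r<e - 1. c r) \<le> m}"

lemma monomial_Q: "(\<Sum>r<e - 1. c r) \<le> m \<Longrightarrow> ymon y q a * ymon hc (e - 1) c \<in> Q m"
  unfolding Q_def by (intro fs.span_base) blast

lemma const_Q: "(\<lambda>_. c) \<in> Q m"
proof -
  have "ymon y q (\<lambda>_. 0) * ymon hc (e - 1) (\<lambda>_. 0) \<in> Q m" by (rule monomial_Q) simp
  then have "fscale c (ymon y q (\<lambda>_. 0) * ymon hc (e - 1) (\<lambda>_. 0)) \<in> Q m"
    unfolding Q_def by (rule fs.span_scale)
  moreover have "fscale c (ymon y q (\<lambda>_. 0) * ymon hc (e - 1) (\<lambda>_. 0)) = (\<lambda>_. c)"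
    by (simp add: fun_eq_iff ymon_def)
  ultimately show ?thesis by simp
qed

lemma filtration_Q: "filtration Q"
  unfolding filtration_def
proof (intro conjI allI ballI)
  show "a - b \<in> Q m" if "a \<in> Q m" "b \<in> Q m" for m a b
    using that unfolding Q_def by (rule fs.span_diff)
  show "1 \<in> Q 0" using const_Q[of 1 0] by (simp add: one_fun_def)
  show "mono Q" unfolding Q_def by (intro monoI fs.span_mono) force
  show "f * g \<in> Q (m + n)" if "f \<in> Q m" "g \<in> Q n" for m n f g
  proof -
    let ?B = "\<lambda>m. {ymon y q a * ymon hc (e - 1) c | a c. (\<Sum>r<e - 1. c r) \<le> m}"
    have "f * g \<in> fs.span (?B (m + n))"
    proof (rule span_mult[OF that[unfolded Q_def]])
      fix u v assume "u \<in> ?B m" "v \<in> ?B n"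
      then obtain a c a' c' where u: "u = ymon y q a * ymon hc (e - 1) c" "(\<Sum>r<e - 1. c r) \<le> m"
        and v: "v = ymon y q a' * ymon hc (e - 1) c'" "(\<Sum>r<e - 1. c' r) \<le> n" by blast
      have "u * v = (ymon y q a * ymon y q a') * (ymon hc (e - 1) c * ymon hc (e - 1) c')"
        by (simp only: u v mult_ac)
      also have "\<dots> = ymon y q (\<lambda>i. a i + a' i) * ymon hc (e - 1) (\<lambda>i. c i + c' i)"
        by (simp only: ymon_add)
      finally have "u * v = ymon y q (\<lambda>i. a i + a' i) * ymon hc (e - 1) (\<lambda>i. c i + c' i)" .
      moreover have "(\<Sum>r<e - 1. c r + c' r) \<le> m + n" using u v by (simp add: sum.distrib)
      ultimately show "u * v \<in> fs.span (?B (m + n))" by (intro fs.span_base) blast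
    qed
    then show ?thesis by (simp only: Q_def)
  qed
qed

lemmas QD = filtrationD[OF filtration_Q]

lemma y_Q: "k < q \<Longrightarrow> y k \<in> Q m"
proof -
  assume "k < q"
  then have "y k = ymon y q ((\<lambda>_. 0)(k := Suc 0)) * ymon hc (e - 1) (\<lambda>_. 0)"
    using ymon_Suc[of k q y "\<lambda>_. 0"] by (simp add: ymon_def)
  also have "\<dots> \<in> Q m" by (rule monomial_Q) simp
  finally show ?thesis .
qed

lemma hc_Q: "r < e - 1 \<Longrightarrow> hc r \<in> Q 1"
proof -
  assume r: "r < e - 1"
  then have "hc r = ymon y q (\<lambda>_. 0) * ymon hc (e - 1) ((\<lambda>_. 0)(r := Suc 0))"
    using ymon_Suc[of r "e - 1" hc "\<lambda>_. 0"] by (simp add: ymon_def)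
  moreover have "(\<Sum>s<e - 1. ((\<lambda>_. 0)(r := Suc 0)) s) \<le> 1"
    using ymon_sum_Suc[OF r, of "\<lambda>_. 0"] by simp
  ultimately show ?thesis using monomial_Q by metis
qed

lemma eta_Q: "\<eta> i \<in> Q 1"
  unfolding \<eta>_def
proof (intro QD(5) const_Q filtration_sum[OF filtration_Q])
  fix r assume "r \<in> {..<e - 1}"
  then show "(\<lambda>_. \<alpha> i ^ Suc r) * hc r \<in> Q 1" using QD(6)[OF const_Q[of _ 0] hc_Q] by simp
qed

lemma coeff_gp: "coeff gp k = (if k = d then 1 else if k < d then (\<lambda>x. x k) else 0)"
  by (auto simp: gp_def coeff_sum)

text \<open>The value of g at a node is some \<open>y k\<close> up to a constant, hence of degree 0.
  This is what makes the elimination of g lower degrees.\<close>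

lemma poly_gp_Q: "i \<in> {1..q} \<Longrightarrow> poly gp (\<eta> i) \<in> Q m"
proof -
  assume "i \<in> {1..q}"
  then have i: "Suc (i - 1) = i" "i - 1 < q" by auto
  have "poly gp (\<eta> i) = y (i - 1) + (\<lambda>_. \<beta> i)" unfolding y_def i(1) by simp
  then show ?thesis using QD(5)[OF y_Q[OF i(2)] const_Q] by metis
qed

lemma eta_diff:
  "\<eta> i - \<eta> j = (\<Sum>r<e - 1. (\<lambda>_. \<alpha> i ^ Suc r - \<alpha> j ^ Suc r) * hc r) + (\<lambda>_. \<alpha> i ^ e - \<alpha> j ^ e)"
  by (simp add: \<eta>_def fun_eq_iff fun_sum_apply algebra_simps flip: sum_subtractf del: power_Suc)

text \<open>The product has d(d + 1)/2 factors of degree 1. As \<open>gp\<close> is monic, it equals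
  its own product with the coefficient of index d, and \<open>vand_mult_coeff\<close> lowers the
  degree by d, thus at least by 1.\<close>

lemma vand_eta_Q:
  assumes "\<sigma> ` {..<Suc d} \<subseteq> {1..q}"
  shows "vand (\<eta> \<circ> \<sigma>) (Suc d) \<in> Q ((\<Sum>i<Suc d. i) - 1)"
proof -
  have "vand (\<eta> \<circ> \<sigma>) (Suc d) * coeff gp d \<in> Q (0 + (\<Sum>i<Suc d. i) - d)"
  proof (rule vand_mult_coeff[OF filtration_Q])
    show "coeff gp k = 0" if "k \<ge> Suc d" for k using that by (simp add: coeff_gp)
    show "(\<eta> \<circ> \<sigma>) i \<in> Q 1" for i unfolding comp_apply by (rule eta_Q)
    show "poly gp ((\<eta> \<circ> \<sigma>) i) \<in> Q 0" if "i < Suc d" for i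
      using poly_gp_Q[of "\<sigma> i"] assms that by auto
  qed simp
  moreover have "coeff gp d = 1" by (simp add: coeff_gp)
  moreover have "0 + (\<Sum>i<Suc d. i) - d \<le> (\<Sum>i<Suc d. i) - 1" using d2 by linarith
  ultimately show ?thesis using QD(7) by (metis mult.right_neutral)
qed

text \<open>In the Rees ring \<open>\<Oplus>\<^sub>m Q m T ^ m\<close> a homogeneous element \<open>a T ^ m\<close> is a multiple of \<open>T\<close> if and
  only if \<open>a \<in> Q (m - 1)\<close>.\<close>

definition rees :: "((nat \<Rightarrow> 'k) \<Rightarrow> 'k) poly set" where
  "rees = {p. \<forall>m. coeff p m \<in> Q m}"

definition rees_T :: "((nat \<Rightarrow> 'k) \<Rightarrow> 'k) poly set" where
  "rees_T = {p. coeff p 0 = 0 \<and> (\<forall>m. coeff p (Suc m) \<in> Q m)}"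

lemma rees_subring: "subring_set rees"
  unfolding subring_set_def
proof (intro conjI ballI)
  show "1 \<in> rees" by (auto simp: rees_def one_pCons coeff_pCons QD split: nat.split)
  fix p r assume pr: "p \<in> rees" "r \<in> rees"
  then show "p - r \<in> rees" by (simp add: rees_def QD(3))
  have "coeff (p * r) m \<in> Q m" for m
    unfolding coeff_mult
  proof (rule filtration_sum[OF filtration_Q])
    fix i assume "i \<in> {..m}"
    then show "coeff p i * coeff r (m - i) \<in> Q m"
      using QD(6)[of "coeff p i" i "coeff r (m - i)" "m - i"] pr by (simp add: rees_def)
  qed
  then show "p * r \<in> rees" by (simp add: rees_def)
qed

lemma rees_T_ideal: "ideal_set rees rees_T"
  unfolding ideal_set_def
proof (intro conjI ballI subsetI)
  fix p assume p: "p \<in> rees_T"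
  show "p \<in> rees"
    unfolding rees_def
  proof (intro CollectI allI)
    show "coeff p m \<in> Q m" for m
      using p QD(2) QD(7)[of "m - 1" m "coeff p m"] by (cases m) (auto simp: rees_T_def)
  qed
  show "p + r \<in> rees_T" if "r \<in> rees_T" for r using p that by (simp add: rees_T_def QD(5))
next
  show "0 \<in> rees_T" by (simp add: rees_T_def QD(2))
next
  fix s p assume s: "s \<in> rees" and p: "p \<in> rees_T"
  have "coeff (s * p) (Suc m) \<in> Q m" for m
    unfolding coeff_mult
  proof (rule filtration_sum[OF filtration_Q])
    fix i assume "i \<in> {..Suc m}"
    then consider "i = Suc m" | "i \<le> m" by fastforce
    then show "coeff s i * coeff p (Suc m - i) \<in> Q m"
    proof cases
      case 1
      then show ?thesis using p by (simp add: rees_T_def QD(2))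
    next
      case 2
      then have "Suc m - i = Suc (m - i)" by simp
      then show ?thesis
        using 2 QD(6)[of "coeff s i" i "coeff p (Suc m - i)" "m - i"] s p
        by (simp add: rees_T_def rees_def)
    qed
  qed
  moreover have "coeff (s * p) 0 = 0" using p by (simp add: coeff_mult rees_T_def)
  ultimately show "s * p \<in> rees_T" by (simp add: rees_T_def)
qed

lemma monom_rees: "a \<in> Q m \<Longrightarrow> monom a m \<in> rees"
  by (auto simp: rees_def QD(2))

lemma monom_rees_T: "monom a (Suc m) \<in> rees_T \<longleftrightarrow> a \<in> Q m"
  by (auto simp: rees_T_def QD(2))

text \<open>Otherwise some prime \<open>M\<close> of the Rees ring contains \<open>rees_T\<close>
  but not the coefficient times T. By \<open>vand_eta_Q\<close> the nodes times T can be grouped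
  into d blocks of elements congruent modulo \<open>M\<close>, and a nonzero determinant S puts the
  coefficient times T in \<open>M\<close>.\<close>

lemma hc_power_Q:
  assumes "r < e - 1"
  shows "\<exists>s. hc r ^ Suc s \<in> Q s"
proof (rule ccontr)
  assume neg: "\<not> ?thesis"
  have mp: "monom (hc r) 1 ^ n = monom (hc r ^ n) n" for n by (simp add: monom_power)
  \<comment> \<open>The power 0 is the constant 1, and elements of \<open>rees_T\<close> have no
    constant coefficient.\<close>
  have "monom (hc r) 1 ^ n \<notin> rees_T" for n
    using neg unfolding mp
    by (cases n) (simp_all add: monom_rees_T del: power_Suc, simp add: rees_T_def)
  then obtain M where M: "prime_set rees M" "rees_T \<subseteq> M" "monom (hc r) 1 \<notin> M"
    by (rule prime_ideal_avoiding_powers[OF rees_subring rees_T_ideal])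
  have iM: "ideal_set rees M" using M(1) by (simp add: prime_set_def)
  define z where "z i = monom (\<eta> i) 1" for i
  obtain P where P: "partition_on {1..q} P" "card P = d"
    "\<And>B i j. B \<in> P \<Longrightarrow> i \<in> B \<Longrightarrow> j \<in> B \<Longrightarrow> z i - z j \<in> M"
  proof (rule vand_partition[OF rees_subring M(1), of "{1..q}" d z])
    show "d \<le> card {1..q}" using e2 by simp
    show "z i \<in> rees" for i unfolding z_def by (rule monom_rees[OF eta_Q])
    fix \<sigma> assume "\<sigma> ` {..<Suc d} \<subseteq> {1..q}"
    have "vand (z \<circ> \<sigma>) (Suc d) = monom (vand (\<eta> \<circ> \<sigma>) (Suc d)) (\<Sum>i<Suc d. i)"
      using vand_monom[of "\<eta> \<circ> \<sigma>" "Suc d"] by (simp add: z_def comp_def)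
    \<comment> \<open>The exponent of T is positive, and one factor T is split off so that
      \<open>monom_rees_T\<close> applies.\<close>
    also have "(\<Sum>i<Suc d. i) = Suc ((\<Sum>i<Suc d. i) - 1)" using d2 by simp
    finally have "vand (z \<circ> \<sigma>) (Suc d) = monom (vand (\<eta> \<circ> \<sigma>) (Suc d)) (Suc ((\<Sum>i<Suc d. i) - 1))" .
    moreover have "\<dots> \<in> rees_T"
      unfolding monom_rees_T by (rule vand_eta_Q) fact
    ultimately show "vand (z \<circ> \<sigma>) (Suc d) \<in> M" using M(2) by auto
  qed auto
  have "monom (hc r) 1 \<in> M"
  proof (rule block_mat_ideal[OF iM _ _ _ P(1) _ det_S[OF P(1,2)], where \<kappa> = "\<lambda>c. [:\<lambda>_. c:]" and v = "\<lambda>r. monom (hc r) 1"])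
    show "comm_ring_hom (\<lambda>c :: 'k. [:\<lambda>_ :: nat \<Rightarrow> 'k. c:])"
      by unfold_locales (simp_all add: fun_eq_iff one_pCons)
    show "[:\<lambda>_. c:] \<in> rees" for c using monom_rees[OF const_Q[of c 0]] by (simp add: monom_0)
    show "card {1..q} = e - 1 + card P" using P(2) d2 e2 by simp
    fix B i j assume B: "B \<in> P" "i \<in> B" "j \<in> B"
    \<comment> \<open>The leading term of h contributes a constant times T, which lies in
      \<open>rees_T\<close>; the unknowns left are the \<open>e - 1\<close> other
      coefficients.\<close>
    let ?c = "monom (\<lambda>_. \<alpha> i ^ e - \<alpha> j ^ e) 1"
    have "?c \<in> M" using M(2) monom_rees_T[of "\<lambda>_. \<alpha> i ^ e - \<alpha> j ^ e" 0] const_Q by auto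
    moreover have "z i - z j = (\<Sum>r<e - 1. [:\<lambda>_. \<alpha> i ^ Suc r - \<alpha> j ^ Suc r:] * monom (hc r) 1) + ?c"
      unfolding z_def diff_monom eta_diff
      by (simp only: add_monom[symmetric] monom_sum) (simp add: smult_monom del: power_Suc)
    ultimately show "(\<Sum>r<e - 1. [:\<lambda>_. \<alpha> i ^ Suc r - \<alpha> j ^ Suc r:] * monom (hc r) 1) \<in> M"
      using ideal_set_diff[OF rees_subring iM P(3)[OF B], of ?c] by simp
  qed (use assms in auto)
  then show False using M(3) by blast
qed

text \<open>By pigeonhole a monomial of degree above the sum of the \<open>s r\<close> contains some
  \<open>hc r ^ Suc (s r)\<close>, and that power lies one step lower in the filtration than its
  degree.\<close>

lemma Q_stable: "\<exists>m0. \<forall>m. Q m \<subseteq> Q m0"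
proof -
  have "\<forall>r. \<exists>s. r < e - 1 \<longrightarrow> hc r ^ Suc s \<in> Q s" using hc_power_Q by blast
  then obtain s where s: "\<And>r. r < e - 1 \<Longrightarrow> hc r ^ Suc (s r) \<in> Q (s r)" by metis
  define m0 where "m0 = (\<Sum>r<e - 1. s r)"
  have step: "Q (Suc m) \<subseteq> Q m" if m: "m \<ge> m0" for m
    unfolding Q_def[of "Suc m"]
  proof (rule fs.span_minimal)
    show "fs.subspace (Q m)" unfolding Q_def by (rule fs.subspace_span)
    show "{ymon y q a * ymon hc (e - 1) c | a c. (\<Sum>r<e - 1. c r) \<le> Suc m} \<subseteq> Q m"
    proof
      fix f assume "f \<in> {ymon y q a * ymon hc (e - 1) c | a c. (\<Sum>r<e - 1. c r) \<le> Suc m}"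
      then obtain a c where f: "f = ymon y q a * ymon hc (e - 1) c" "(\<Sum>r<e - 1. c r) \<le> Suc m" by blast
      show "f \<in> Q m"
      proof (cases "(\<Sum>r<e - 1. c r) \<le> m")
        case True
        then show ?thesis unfolding Q_def f(1) by (intro fs.span_base) blast
      next
        case False
        have "\<exists>r<e - 1. c r > s r"
        proof (rule ccontr)
          assume "\<not> ?thesis"
          then have "c r \<le> s r" if "r \<in> {..<e - 1}" for r using that by force
          then have "(\<Sum>r<e - 1. c r) \<le> m0" unfolding m0_def by (rule sum_mono)
          then show False using False m by simp
        qed
        then obtain r where r: "r < e - 1" "c r > s r" by blast
        \<comment> \<open>The exponents left after the removal of
          \<open>hc r ^ Suc (s r)\<close>.\<close>
        define b where "b = c(r := c r - Suc (s r))"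
        define u where "u = (\<lambda>_. 0 :: nat)(r := Suc (s r))"
        have bc: "c i = u i + b i" for i using r by (simp add: b_def u_def)
        have "ymon hc (e - 1) u = hc r ^ Suc (s r)"
        proof -
          have "ymon hc (e - 1) u = (\<Prod>i<e - 1. if i = r then hc r ^ Suc (s r) else 1)"
            unfolding ymon_def u_def by (intro prod.cong) auto
          then show ?thesis using r by (simp add: prod.delta del: power_Suc)
        qed
        moreover have "ymon hc (e - 1) c = ymon hc (e - 1) u * ymon hc (e - 1) b"
          unfolding ymon_add by (intro arg_cong[of _ _ "ymon hc (e - 1)"] ext bc)
        ultimately have "f = ymon y q a * ymon hc (e - 1) b * hc r ^ Suc (s r)"
          by (simp only: f(1) mult_ac)
        moreover have "(\<Sum>i<e - 1. c i) = Suc (s r) + (\<Sum>i<e - 1. b i)"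
        proof -
          have "(\<Sum>i<e - 1. u i) = Suc (s r)" using r by (simp add: u_def)
          then show ?thesis unfolding bc sum.distrib by simp
        qed
        then have eq: "(\<Sum>i<e - 1. b i) + s r = m" using f(2) False by linarith
        have "ymon y q a * ymon hc (e - 1) b \<in> Q (\<Sum>i<e - 1. b i)"
          unfolding Q_def by (intro fs.span_base) blast
        then have "ymon y q a * ymon hc (e - 1) b * hc r ^ Suc (s r) \<in> Q m"
          using QD(6)[OF _ s[OF r(1)], of _ "\<Sum>i<e - 1. b i"] unfolding eq by blast
        ultimately show ?thesis by metis
      qed
    qed
  qed
  have "Q (m0 + k) \<subseteq> Q m0" for k
  proof (induction k)
    case (Suc k)
    then show ?case using step[of "m0 + k"] by simp
  qed simp
  moreover have "Q m \<subseteq> Q (m0 + m)" for m using QD(7)[of m "m0 + m"] by auto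
  ultimately show ?thesis by blast
qed

text \<open>The stable value \<open>C\<close> of the filtration is a ring that contains the
  \<open>y k\<close> and the coefficients of h; those of g are still missing. They acquire values in
  \<open>C\<close> after multiplication by Vandermonde products of d nodes, and the ideal
  \<open>I\<close> of all such common denominators turns out to contain 1.\<close>

lemma polyfun_Q: "\<exists>m. polyfun q \<subseteq> Q m"
proof -
  obtain m0 where m0: "\<And>m. Q m \<subseteq> Q m0" using Q_stable by blast
  define C where "C = Q m0"
  have QC: "Q m \<subseteq> C" for m using m0 by (simp add: C_def)
  have C_mult: "a * b \<in> C" if "a \<in> C" "b \<in> C" for a b
    using QD(6)[of a m0 b m0] that QC unfolding C_def by blast
  have C_sub: "subring_set C"
    unfolding subring_set_def using C_mult QD(1,3) by (auto simp: C_def)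
  have C_filt: "filtration (\<lambda>_. C)"
    using C_sub unfolding filtration_def subring_set_def by (auto intro: monoI)
  define I where "I = {v \<in> C. \<forall>j<d. v * (\<lambda>x. x j) \<in> C}"
  have I: "ideal_set C I"
    unfolding ideal_set_def
  proof (intro conjI ballI)
    show "I \<subseteq> C" by (auto simp: I_def)
    show "0 \<in> I" using subring_setD(2)[OF C_sub] by (simp add: I_def)
    show "a + b \<in> I" if "a \<in> I" "b \<in> I" for a b
      using that subring_setD(6)[OF C_sub] by (simp add: I_def distrib_right)
    show "s * a \<in> I" if "s \<in> C" "a \<in> I" for s a
      using that C_mult by (simp add: I_def mult.assoc)
  qed
  have vI: "vand (\<eta> \<circ> \<sigma>) d \<in> I" if \<sigma>: "\<sigma> ` {..<d} \<subseteq> {1..q}" for \<sigma>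
  proof -
    \<comment> \<open>\<open>gp\<close> without its leading term: its degree is below
      \<open>d\<close>, so \<open>d\<close> nodes suffice, and its values at the nodes stay in
      \<open>C\<close> because powers of nodes do.\<close>
    define f where "f = (\<Sum>i<d. monom (\<lambda>x :: nat \<Rightarrow> 'k. x i) i)"
    have cf: "coeff f k = (if k < d then (\<lambda>x. x k) else 0)" for k
      by (auto simp: f_def coeff_sum)
    have "vand (\<eta> \<circ> \<sigma>) d * coeff f j \<in> C" if "j < d" for j
    proof (rule vand_mult_coeff[OF C_filt])
      show "coeff f k = 0" if "k \<ge> d" for k using that by (simp add: cf)
      show "(\<eta> \<circ> \<sigma>) i \<in> C" for i using eta_Q QC by auto
      fix i assume "i < d"
      have "poly f ((\<eta> \<circ> \<sigma>) i) = poly gp (\<eta> (\<sigma> i)) - \<eta> (\<sigma> i) ^ d"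
        by (simp add: f_def gp_def poly_monom)
      also have "\<dots> \<in> C"
      proof (intro subring_setD(3,7)[OF C_sub])
        have "\<sigma> i \<in> {1..q}" using \<open>i < d\<close> \<sigma> by blast
        then show "poly gp (\<eta> (\<sigma> i)) \<in> C" using poly_gp_Q QC by blast
        show "\<eta> (\<sigma> i) \<in> C" using eta_Q QC by blast
      qed
      finally show "poly f ((\<eta> \<circ> \<sigma>) i) \<in> C" .
    qed (fact that)
    then have "vand (\<eta> \<circ> \<sigma>) d * (\<lambda>x. x j) \<in> C" if "j < d" for j
      using that cf[of j] by (metis (full_types))
    moreover have "vand (\<eta> \<circ> \<sigma>) d \<in> C"
      unfolding vand_def comp_def using eta_Q QC
      by (intro subring_set_prod[OF C_sub] subring_setD(3)[OF C_sub]) auto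
    ultimately show ?thesis by (simp add: I_def)
  qed
  have "1 \<in> I"
  proof (rule ccontr)
    assume "1 \<notin> I"
    then have "1 ^ n \<notin> I" for n by simp
    then obtain M where M: "prime_set C M" "I \<subseteq> M"
      by (rule prime_ideal_avoiding_powers[OF C_sub I])
    have iM: "ideal_set C M" "1 \<notin> M" using M(1) by (simp_all add: prime_set_def)
    obtain P where P: "partition_on {1..q} P" "card P = d - 1"
      "\<And>B i j. B \<in> P \<Longrightarrow> i \<in> B \<Longrightarrow> j \<in> B \<Longrightarrow> \<eta> i - \<eta> j \<in> M"
    proof (rule vand_partition[OF C_sub M(1), of "{1..q}" "d - 1" \<eta>])
      show "\<eta> i \<in> C" for i using eta_Q QC by blast
      show "vand (\<eta> \<circ> \<sigma>) (Suc (d - 1)) \<in> M" if "\<sigma> ` {..<Suc (d - 1)} \<subseteq> {1..q}" for \<sigma>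
        using that vI[of \<sigma>] M(2) d2 by (auto simp: Suc_diff_Suc)
    qed auto
    \<comment> \<open>The coefficients of h from index 1 on, including the leading coefficient 1 as
      the last entry. The differences of nodes are homogeneous linear in these \<open>e\<close>
      entries, so a nonzero determinant R puts 1 in \<open>M\<close>.\<close>
    define v where "v r = (if r < e - 1 then hc r else 1)" for r
    have "v (e - 1) \<in> M"
    proof (rule block_mat_ideal[OF iM(1) _ _ _ P(1) _ det_R[OF P(1,2)], where \<kappa> = "\<lambda>c _. c" and v = v])
      show "comm_ring_hom (\<lambda>(c :: 'k) (_ :: nat \<Rightarrow> 'k). c)"
        by unfold_locales (simp_all add: fun_eq_iff)
      show "(\<lambda>_. c) \<in> C" for c using const_Q by (simp add: C_def)
      show "card {1..q} = e + card P" using P(2) d2 by simp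
      fix B i j assume "B \<in> P" "i \<in> B" "j \<in> B"
      have e: "{..<e} = insert (e - 1) {..<e - 1}" "Suc (e - 1) = e" using e2 by auto
      have "(\<Sum>r<e. (\<lambda>_. \<alpha> i ^ Suc r - \<alpha> j ^ Suc r) * v r) =
          (\<Sum>r<e - 1. (\<lambda>_. \<alpha> i ^ Suc r - \<alpha> j ^ Suc r) * v r) + (\<lambda>_. \<alpha> i ^ e - \<alpha> j ^ e) * v (e - 1)"
        unfolding e(1) by (subst sum.insert) (simp_all only: e(2) add.commute finite_lessThan lessThan_iff less_irrefl not_False_eq_True)
      also have "\<dots> = \<eta> i - \<eta> j"
        unfolding eta_diff by (intro arg_cong2[of _ _ _ _ "(+)"] sum.cong) (simp_all add: v_def)
      finally show "(\<Sum>r<e. (\<lambda>_. \<alpha> i ^ Suc r - \<alpha> j ^ Suc r) * v r) \<in> M"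
        using P(3)[OF \<open>B \<in> P\<close> \<open>i \<in> B\<close> \<open>j \<in> B\<close>] by simp
    qed (use e2 in auto)
    then show False using iM(2) by (simp add: v_def)
  qed
  then have gC: "(\<lambda>x. x j) \<in> C" if "j < d" for j using that by (simp add: I_def)
  have var: "(\<lambda>x. x j) \<in> C" if "j < q" for j
  proof (cases "j < d")
    case False
    then have "j - d < e - 1" using that by linarith
    then have "hc (j - d) \<in> C" using hc_Q QC by blast
    then show ?thesis using False by (simp add: hc_def)
  qed (rule gC)
  have "f \<in> C" if "f \<in> polyfun q" for f
    using that
  proof (induction rule: polyfun.induct)
    case (const c)
    show "(\<lambda>_. c) \<in> C" using const_Q by (simp add: C_def)
  next
    case (var i)
    then show "(\<lambda>x. x i) \<in> C" by (rule \<open>\<And>j. j < q \<Longrightarrow> (\<lambda>x. x j) \<in> C\<close>)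
  next
    case (add f g)
    show "f + g \<in> C" by (intro subring_setD(6)[OF C_sub] add)
  next
    case (mult f g)
    show "f * g \<in> C" by (intro C_mult mult)
  qed
  then show ?thesis unfolding C_def by blast
qed

lemma y_polyfun: "k < q \<Longrightarrow> y k \<in> polyfun q"
proof -
  have hc: "hc r \<in> polyfun q" if "r < e - 1" for r
    unfolding hc_def using that by (intro polyfun.var) simp
  have eta: "\<eta> i \<in> polyfun q" for i
    unfolding \<eta>_def
    by (intro polyfun.add polyfun.const subring_set_sum[OF polyfun_subring] polyfun.mult hc) simp
  have "poly gp (\<eta> i) = \<eta> i ^ d + (\<Sum>j<d. (\<lambda>x. x j) * \<eta> i ^ j)" for i
    by (simp add: gp_def poly_sum poly_monom)
  moreover have "\<eta> i ^ d + (\<Sum>j<d. (\<lambda>x. x j) * \<eta> i ^ j) \<in> polyfun q" for i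
    using e2 by (intro polyfun.add subring_set_sum[OF polyfun_subring] polyfun.mult polyfun.var
      polyfun_subringD(7) eta) simp
  ultimately have "poly gp (\<eta> i) \<in> polyfun q" for i by metis
  then show "y k \<in> polyfun q"
    unfolding y_def by (intro polyfun_subringD(3) polyfun.const)
qed

text \<open>By \<open>polyfun_Q\<close> the monomials of bounded degree in the coefficients of h are
  a finite set of module generators, so the map is finite.\<close>

lemma finite_nonempty_zeros:
  "finite {x \<in> affine_space {..<q}. \<forall>k<q. y k x = 0}"
  "\<exists>x\<in>affine_space {..<q}. \<forall>k<q. y k x = 0"
proof -
  obtain m where m: "polyfun q \<subseteq> Q m" using polyfun_Q by blast
  define W where "W = {ymon hc (e - 1) c | c. (\<Sum>r<e - 1. c r) \<le> m}"
  interpret finite_polynomial_map q y W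
  proof
    show "0 < q" using d2 by simp
    show "y i \<in> polyfun q" if "i < q" for i using that by (rule y_polyfun)
    have "W \<subseteq> ymon hc (e - 1) ` ({..<e - 1} \<rightarrow>\<^sub>E {..m})"
    proof
      fix w assume "w \<in> W"
      then obtain c where c: "w = ymon hc (e - 1) c" "(\<Sum>r<e - 1. c r) \<le> m" by (auto simp: W_def)
      have "c r \<le> m" if "r < e - 1" for r
        using member_le_sum[of r "{..<e - 1}" c] that c(2) by simp
      then have "restrict c {..<e - 1} \<in> {..<e - 1} \<rightarrow>\<^sub>E {..m}" by auto
      moreover have "w = ymon hc (e - 1) (restrict c {..<e - 1})" by (simp add: c ymon_def)
      ultimately show "w \<in> ymon hc (e - 1) ` ({..<e - 1} \<rightarrow>\<^sub>E {..m})" by blast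
    qed
    then show "finite W" by (rule finite_subset) (intro finite_imageI finite_PiE finite_lessThan finite_atMost)
    show "W \<subseteq> polyfun q"
      unfolding W_def by (auto intro!: ymon_polyfun polyfun.var simp: hc_def)
    have "{ymon y q a * ymon hc (e - 1) c | a c. (\<Sum>r<e - 1. c r) \<le> m}
        = {ymon y q a * w | a w. w \<in> W}" unfolding W_def by blast
    then show "polyfun q \<subseteq> fs.span {ymon y q a * w | a w. w \<in> W}"
      using m unfolding Q_def by simp
  qed
  show "finite {x \<in> affine_space {..<q}. \<forall>k<q. y k x = 0}" by (rule finite_common_zeros)
  show "\<exists>x\<in>affine_space {..<q}. \<forall>k<q. y k x = 0" by (rule common_zero)
qed

section \<open>From coordinate vectors to pairs of polynomials\<close>

definition g_of :: "(nat \<Rightarrow> 'k) \<Rightarrow> 'k poly" where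
  "g_of x = monom 1 d + (\<Sum>i<d. monom (x i) i)"

definition h_of :: "(nat \<Rightarrow> 'k) \<Rightarrow> 'k poly" where
  "h_of x = monom 1 e + (\<Sum>r<e - 1. monom (x (d + r)) (Suc r))"

lemma y_apply: "y k x = poly (pcompose (g_of x) (h_of x)) (\<alpha> (Suc k)) - \<beta> (Suc k)"
proof -
  have "\<eta> i x = poly (h_of x) (\<alpha> i)" for i
    by (simp add: \<eta>_def h_of_def fun_sum_apply poly_sum poly_monom hc_def mult_ac del: power_Suc)
  moreover have "poly gp u x = poly (g_of x) (u x)" for u
    by (simp add: gp_def g_of_def fun_sum_apply fun_power_apply poly_sum poly_monom)
  ultimately show ?thesis by (simp add: y_def poly_pcompose)
qed

lemma coeff_g_of: "coeff (g_of x) k = (if k = d then 1 else if k < d then x k else 0)"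
  by (auto simp: g_of_def coeff_sum)

lemma coeff_h_of: "coeff (h_of x) k = (if k = e then 1 else if 0 < k \<and> k < e then x (d + k - 1) else 0)"
proof (cases k)
  case 0
  then show ?thesis using e2 by (simp add: h_of_def coeff_sum)
next
  case (Suc r)
  have "coeff (\<Sum>r<e - 1. monom (x (d + r)) (Suc r)) (Suc r) = (if r < e - 1 then x (d + r) else 0)"
    by (simp add: coeff_sum)
  then show ?thesis using e2 by (auto simp: h_of_def Suc)
qed

lemma monic_g_of: "g_of x \<in> monic_polys d"
proof -
  have "degree (g_of x) = d"
    by (intro antisym degree_le le_degree) (auto simp: coeff_g_of)
  then show ?thesis by (simp add: monic_polys_def coeff_g_of)
qed

lemma monic_h_of: "h_of x \<in> monic_polys0 e"
proof -
  have "degree (h_of x) = e"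
    by (intro antisym degree_le le_degree) (auto simp: coeff_h_of)
  then show ?thesis using e2 by (simp add: monic_polys0_def monic_polys_def coeff_h_of)
qed

lemma monic_coeff: "g \<in> monic_polys n \<Longrightarrow> coeff g n = 1" "g \<in> monic_polys n \<Longrightarrow> k > n \<Longrightarrow> coeff g k = 0"
  by (auto simp: monic_polys_def intro: coeff_eq_0)

theorem incidence_fiber_finite_nonempty:
  assumes "\<alpha> \<in> points d e" "\<beta> \<in> points d e"
  shows "finite (incidence_fiber d e \<alpha> \<beta>)" "incidence_fiber d e \<alpha> \<beta> \<noteq> {}"
proof -
  have fib: "(g_of x, h_of x, \<alpha>, \<beta>) \<in> incidence_fiber d e \<alpha> \<beta> \<longleftrightarrow> (\<forall>k<q. y k x = 0)" for x
  proof -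
    have "(\<forall>k<q. y k x = 0) \<longleftrightarrow> (\<forall>i\<in>{1..q}. poly (pcompose (g_of x) (h_of x)) (\<alpha> i) = \<beta> i)"
      unfolding y_apply right_minus_eq
    proof safe
      fix i assume "\<forall>k<q. poly (g_of x \<circ>\<^sub>p h_of x) (\<alpha> (Suc k)) = \<beta> (Suc k)" "i \<in> {1..q}"
      then show "poly (g_of x \<circ>\<^sub>p h_of x) (\<alpha> i) = \<beta> i" by (cases i) auto
    qed auto
    then show ?thesis
      using assms monic_g_of[of x] monic_h_of[of x]
      by (simp add: incidence_fiber_def incidence_def ambient_set_def incidence_proj_def npoints_def)
  qed
  show "incidence_fiber d e \<alpha> \<beta> \<noteq> {}" using fib finite_nonempty_zeros(2) by blast
  have "incidence_fiber d e \<alpha> \<beta> \<subseteq>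
      (\<lambda>x. (g_of x, h_of x, \<alpha>, \<beta>)) ` {x \<in> affine_space {..<q}. \<forall>k<q. y k x = 0}"
  proof
    fix t assume t: "t \<in> incidence_fiber d e \<alpha> \<beta>"
    then obtain g h where gh: "t = (g, h, \<alpha>, \<beta>)" "g \<in> monic_polys d" "h \<in> monic_polys0 e"
      by (auto simp: incidence_fiber_def incidence_def ambient_set_def incidence_proj_def)
    \<comment> \<open>The shift by one after position \<open>d\<close> is due to h having no
      constant coefficient: the coordinate \<open>d\<close> is its coefficient of index 1.\<close>
    define x where "x = restrict (\<lambda>i. if i < d then coeff g i else coeff h (Suc (i - d))) {..<q}"
    have "g_of x = g"
    proof (rule poly_eqI)
      fix k
      consider "k = d" | "k < d" | "k > d" by linarith
      then show "coeff (g_of x) k = coeff g k"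
        using monic_coeff[OF gh(2)] e2 by cases (simp_all add: coeff_g_of x_def)
    qed
    moreover have "h_of x = h"
    proof (rule poly_eqI)
      fix k
      have h: "h \<in> monic_polys e" "coeff h 0 = 0" using gh(3) by (auto simp: monic_polys0_def)
      consider "k = e" | "k = 0" | "0 < k" "k < e" | "k > e" by linarith
      then show "coeff (h_of x) k = coeff h k"
      proof cases
        case 3
        then have "Suc (d + k - 1 - d) = k" "d + k - 1 < q" "\<not> d + k - 1 < d" by linarith+
        then have "x (d + k - 1) = coeff h k" unfolding x_def by simp
        then show ?thesis using 3 by (simp add: coeff_h_of)
      qed (use monic_coeff[OF h(1)] h(2) e2 in \<open>simp_all add: coeff_h_of\<close>)
    qed
    ultimately have tx: "t = (g_of x, h_of x, \<alpha>, \<beta>)" using gh(1) by simp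
    then have "\<forall>k<q. y k x = 0" using t fib by metis
    moreover have "x \<in> affine_space {..<q}" by (simp add: x_def affine_space_def)
    ultimately show "t \<in> (\<lambda>x. (g_of x, h_of x, \<alpha>, \<beta>)) ` {x \<in> affine_space {..<q}. \<forall>k<q. y k x = 0}"
      using tx by blast
  qed
  then show "finite (incidence_fiber d e \<alpha> \<beta>)"
    by (rule finite_subset) (intro finite_imageI finite_nonempty_zeros)
qed

end


section \<open>Fibers and dominance\<close>

lemma mem_affine_space: "x \<in> affine_space I \<longleftrightarrow> (\<forall>i. i \<notin> I \<longrightarrow> x i = undefined)"
  by (auto simp: affine_space_def PiE_iff extensional_def)

lemma case_sum_affine_space:
  "case_sum x y \<in> affine_space (I <+> J) \<longleftrightarrow> x \<in> affine_space I \<and> y \<in> affine_space J"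
  unfolding mem_affine_space split_sum_all by (auto simp: Plus_def image_iff)

lemma tuple_coords_affine_space:
  "z \<in> ambient_set d e \<Longrightarrow>
    tuple_coords d e z \<in> affine_space ({0..<d} <+> {1..<e} <+> {1..npoints d e} <+> {1..npoints d e})"
  by (cases z) (simp add: ambient_set_def tuple_coords_def case_sum_affine_space,
      simp add: affine_space_def)

lemma topspace_subtopology_ambient:
  "topspace (subtopology (ambient d e) S) = S \<inter> (ambient_set d e :: 'k::idom tuple set)"
proof -
  have "topspace (ambient d e :: 'k tuple topology) = ambient_set d e"
    using tuple_coords_affine_space
    by (auto simp: ambient_def topspace_pullback_topology topspace_zariski)
  then show ?thesis by (simp add: Int_commute)
qed

text \<open>The coordinates omit only the leading coefficients and the constant coefficient of h,
  which are fixed on the ambient set.\<close>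

lemma tuple_coords_inj: "inj_on (tuple_coords d e) (ambient_set d e :: 'k::comm_ring_1 tuple set)"
proof (rule inj_onI)
  fix s t :: "'k tuple"
  assume st: "s \<in> ambient_set d e" "t \<in> ambient_set d e" "tuple_coords d e s = tuple_coords d e t"
  obtain g h \<alpha> \<beta> where s: "s = (g, h, \<alpha>, \<beta>)" by (cases s)
  obtain g' h' \<alpha>' \<beta>' where t: "t = (g', h', \<alpha>', \<beta>')" by (cases t)
  note eq = fun_cong[OF st(3), unfolded s t tuple_coords_def, simplified]
  have "restrict (coeff g) {0..<d} i = restrict (coeff g') {0..<d} i" for i using eq[of "Inl i"] by simp
  then have g: "coeff g i = coeff g' i" if "i < d" for i using that by (metis atLeastLessThan_iff le0 restrict_apply')
  have "restrict (coeff h) {1..<e} i = restrict (coeff h') {1..<e} i" for i using eq[of "Inr (Inl i)"] by simp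
  then have h: "coeff h i = coeff h' i" if "0 < i" "i < e" for i
    using that by (metis One_nat_def Suc_leI atLeastLessThan_iff restrict_apply')
  have "\<alpha> = \<alpha>'"
  proof
    show "\<alpha> i = \<alpha>' i" for i using eq[of "Inr (Inr (Inl i))"] by simp
  qed
  moreover have "\<beta> = \<beta>'"
  proof
    show "\<beta> i = \<beta>' i" for i using eq[of "Inr (Inr (Inr i))"] by simp
  qed
  moreover have "g = g'"
  proof (rule poly_eqI)
    have m: "degree g = d" "degree g' = d" "coeff g d = 1" "coeff g' d = 1"
      using st(1,2) by (auto simp: s t ambient_set_def monic_polys_def)
    show "coeff g i = coeff g' i" for i
      using g[of i] m by (cases i d rule: linorder_cases) (auto simp: coeff_eq_0)
  qed
  moreover have "h = h'"
  proof (rule poly_eqI)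
    have m: "degree h = e" "degree h' = e" "coeff h e = 1" "coeff h' e = 1" "coeff h 0 = 0" "coeff h' 0 = 0"
      using st(1,2) by (auto simp: s t ambient_set_def monic_polys0_def monic_polys_def)
    show "coeff h i = coeff h' i" for i
    proof (cases "i = 0")
      case False
      then show ?thesis
        using h[of i] m by (cases i e rule: linorder_cases) (auto simp: coeff_eq_0)
    qed (simp add: m)
  qed
  ultimately show "s = t" by (simp add: s t)
qed

lemma closedin_ambient_point:
  fixes z :: "'k::idom tuple"
  assumes "z \<in> ambient_set d e"
  shows "closedin (ambient d e) {z}"
proof -
  from closedin_pullback_topology[OF closedin_zariski_point[OF tuple_coords_affine_space[OF assms]], of "ambient_set d e" "tuple_coords d e"]
  have "closedin (ambient d e) (tuple_coords d e -` {tuple_coords d e z} \<inter> ambient_set d e)"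
    by (simp add: ambient_def)
  also have "tuple_coords d e -` {tuple_coords d e z} \<inter> ambient_set d e = {z}"
    using assms tuple_coords_inj[of d e] by (auto dest: inj_onD)
  finally show ?thesis .
qed

lemma interpolation_of_R2:
  assumes "d \<ge> 2" "e \<ge> 2" "meval (to_ac :: 'a::field \<Rightarrow> 'a alg_closure) \<alpha> (R2 d e) \<noteq> 0"
  shows "interpolation d e \<alpha>"
proof -
  let ?U = "{1..d + e - 1}"
  have fin: "finite {P. partition_on ?U P \<and> card P = m}" for m
    by (rule finite_subset[OF _ finitely_many_partition_on[of ?U]]) auto
  have "(\<Prod>Q | partition_on ?U Q \<and> card Q = d - 1. det (block_mat e Q \<alpha>)) \<noteq> 0"
    "(\<Prod>P | partition_on ?U P \<and> card P = d. det (block_mat (e - 1) P \<alpha>)) \<noteq> 0"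
    using assms(3) unfolding meval_R2[OF to_ac_hom] npoints_def by auto
  then show ?thesis
    unfolding prod_zero_iff[OF fin] by unfold_locales (use assms in auto)
qed

section \<open>Density in the target\<close>

lemma topspace_target:
  "topspace (target d e :: ((nat \<Rightarrow> 'k::idom) \<times> (nat \<Rightarrow> 'k)) topology) = points d e \<times> points d e"
  by (auto simp: target_def topspace_pullback_topology topspace_zariski case_sum_affine_space)

text \<open>If a point were missing, some polynomial that vanishes on \<open>Z\<close> would be
  nonzero there. It and \<open>R2\<close> would both be nonzero at some point of a line in the
  target, but such a point lies in \<open>Z\<close> by hypothesis.\<close>

lemma closedin_target_dense:
  fixes Z :: "((nat \<Rightarrow> 'a::field alg_closure) \<times> (nat \<Rightarrow> 'a alg_closure)) set"
  assumes de: "d \<ge> 2" "e \<ge> 2" and Z: "closedin (target d e) Z"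
    and R2: "\<And>\<alpha> \<beta>. \<alpha> \<in> points d e \<Longrightarrow> \<beta> \<in> points d e \<Longrightarrow> meval to_ac \<alpha> (R2 d e :: (nat, 'a) mpoly) \<noteq> 0 \<Longrightarrow> (\<alpha>, \<beta>) \<in> Z"
  shows "Z = points d e \<times> points d e"
proof
  let ?I = "{1..npoints d e} <+> {1..npoints d e}"
  let ?c = "\<lambda>(\<alpha>, \<beta>). case_sum \<alpha> \<beta> :: nat + nat \<Rightarrow> 'a alg_closure"
  show sub: "Z \<subseteq> points d e \<times> points d e"
    using closedin_subset[OF Z] by (simp add: topspace_target)
  have "openin (target d e) (points d e \<times> points d e - Z)"
    using Z by (simp add: closedin_def topspace_target)
  then obtain S :: "(nat + nat, 'a alg_closure) mpoly set" where
    S: "points d e \<times> points d e - Z = ?c -` (affine_space ?I - zero_locus ?I S) \<inter> (points d e \<times> points d e)"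
    unfolding target_def openin_pullback_topology openin_zariski by blast
  have ext: "case_sum \<alpha> \<beta> \<in> affine_space ?I"
    if "\<alpha> \<in> points d e" "\<beta> \<in> points d e" for \<alpha> \<beta> :: "nat \<Rightarrow> 'a alg_closure"
    using that by (simp add: case_sum_affine_space)
  have mem: "(\<alpha>, \<beta>) \<in> Z \<longleftrightarrow> (\<forall>p\<in>S. meval (\<lambda>c. c) (case_sum \<alpha> \<beta>) p = 0)"
    if "\<alpha> \<in> points d e" "\<beta> \<in> points d e" for \<alpha> \<beta>
  proof -
    have "(\<alpha>, \<beta>) \<in> points d e \<times> points d e - Z \<longleftrightarrow> case_sum \<alpha> \<beta> \<notin> zero_locus ?I S"
      unfolding S using that ext[OF that] by simp
    then show ?thesis using that ext[OF that] by (auto simp: zero_locus_def)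
  qed
  show "points d e \<times> points d e \<subseteq> Z"
  proof
    fix t :: "(nat \<Rightarrow> 'a alg_closure) \<times> (nat \<Rightarrow> 'a alg_closure)"
    assume "t \<in> points d e \<times> points d e"
    then obtain \<alpha>1 \<beta>1 where t: "t = (\<alpha>1, \<beta>1)" "\<alpha>1 \<in> points d e" "\<beta>1 \<in> points d e" by blast
    show "t \<in> Z"
    proof (rule ccontr)
      assume "t \<notin> Z"
      then obtain p where p: "p \<in> S" "meval (\<lambda>c. c) (case_sum \<alpha>1 \<beta>1) p \<noteq> 0" using mem t by auto
      obtain \<alpha>0 where \<alpha>0: "\<alpha>0 \<in> points d e" "meval to_ac \<alpha>0 (R2 d e :: (nat, 'a) mpoly) \<noteq> 0"
        using R2_nonzero[OF de] by blast
      define F where "F x = meval (\<lambda>c. c) x p" for x :: "nat + nat \<Rightarrow> 'a alg_closure"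
      \<comment> \<open>\<open>R2\<close> as a function on the target, depending on the first half
        of the coordinates only; the other end of the line can therefore keep
        \<open>\<beta>1\<close>.\<close>
      define G where "G x = meval to_ac (x \<circ> Inl) (R2 d e :: (nat, 'a) mpoly)" for x :: "nat + nat \<Rightarrow> 'a alg_closure"
      have "line_poly F" unfolding F_def by (rule line_poly_meval)
      moreover have "line_poly G" unfolding G_def by (rule line_poly_comp[OF line_poly_meval])
      moreover have "case_sum \<alpha>1 \<beta>1 \<in> affine_space ?I" by (rule ext[OF t(2,3)])
      moreover have "F (case_sum \<alpha>1 \<beta>1) \<noteq> 0" using p(2) by (simp add: F_def)
      moreover have "case_sum \<alpha>0 \<beta>1 \<in> affine_space ?I" by (rule ext[OF \<alpha>0(1) t(3)])
      moreover have "G (case_sum \<alpha>0 \<beta>1) \<noteq> 0" using \<alpha>0(2) by (simp add: G_def comp_def)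
      ultimately obtain u where u: "u \<in> affine_space ?I" "F u \<noteq> 0" "G u \<noteq> 0"
        using line_poly_both_nonzero[of F G "case_sum \<alpha>1 \<beta>1" ?I "case_sum \<alpha>0 \<beta>1"] by blast
      have uu: "case_sum (u \<circ> Inl) (u \<circ> Inr) = u" by (auto split: sum.split)
      then have pts: "u \<circ> Inl \<in> points d e" "u \<circ> Inr \<in> points d e"
        using u(1) case_sum_affine_space by metis+
      have "(u \<circ> Inl, u \<circ> Inr) \<in> Z" using R2[OF pts] u(3) by (simp add: G_def)
      then have "F u = 0" using mem[OF pts] p(1) by (simp add: F_def uu)
      then show False using u(2) by simp
    qed
  qed
qed

theorem corollary3p4:
  fixes d e :: nat
  assumes "d \<ge> 2" "e \<ge> 2" "\<not> CHAR('a::field) dvd d"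
  shows "dominant (subtopology (ambient d e) (incidence d e)) (target d e)
           (incidence_proj :: 'a alg_closure tuple \<Rightarrow> _) \<and>
         (\<forall>\<alpha>\<in>affine_space {1..d + e - 1}. \<forall>\<beta>\<in>affine_space {1..d + e - 1}.
            meval (to_ac :: 'a \<Rightarrow> 'a alg_closure) \<alpha> (R2 d e) \<noteq> 0 \<longrightarrow>
            krull_dim (subtopology (ambient d e) (incidence_fiber d e \<alpha> \<beta>)) = 0)"
proof -
  have inc: "incidence d e \<subseteq> (ambient_set d e :: 'a alg_closure tuple set)"
    by (auto simp: incidence_def)
  have fib: "finite (incidence_fiber d e \<alpha> \<beta>) \<and> incidence_fiber d e \<alpha> \<beta> \<noteq> {}"
    if "\<alpha> \<in> points d e" "\<beta> \<in> points d e" "meval (to_ac :: 'a \<Rightarrow> 'a alg_closure) \<alpha> (R2 d e) \<noteq> 0" for \<alpha> \<beta>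
  proof -
    interpret interpolation d e \<alpha> \<beta> by (rule interpolation_of_R2[OF assms(1,2) that(3)])
    show ?thesis using incidence_fiber_finite_nonempty[OF that(1,2)] by blast
  qed
  have "dominant (subtopology (ambient d e) (incidence d e)) (target d e)
      (incidence_proj :: 'a alg_closure tuple \<Rightarrow> _)" (is "dominant ?T _ _")
    unfolding dominant_def
  proof
    have top: "topspace ?T = incidence d e" unfolding topspace_subtopology_ambient using inc by blast
    have img: "incidence_proj ` topspace ?T \<subseteq> topspace (target d e :: ((nat \<Rightarrow> 'a alg_closure) \<times> _) topology)"
      unfolding top topspace_target by (auto simp: incidence_def ambient_set_def incidence_proj_def)
    then show "incidence_proj \<in> topspace ?T \<rightarrow> topspace (target d e)" by blast
    \<comment> \<open>Nonempty fibers put every point with \<open>R2\<close> nonzero in the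
      image.\<close>
    have "(target d e closure_of (incidence_proj ` topspace ?T)) = points d e \<times> points d e"
    proof (rule closedin_target_dense[OF assms(1,2)])
      fix \<alpha> \<beta> :: "nat \<Rightarrow> 'a alg_closure"
      assume "\<alpha> \<in> points d e" "\<beta> \<in> points d e" "meval to_ac \<alpha> (R2 d e :: (nat, 'a) mpoly) \<noteq> 0"
      then obtain z where "z \<in> incidence_fiber d e \<alpha> \<beta>" using fib by blast
      then have "(\<alpha>, \<beta>) \<in> incidence_proj ` topspace ?T"
        unfolding top by (auto simp: incidence_fiber_def image_iff intro!: bexI[of _ z])
      then show "(\<alpha>, \<beta>) \<in> target d e closure_of (incidence_proj ` topspace ?T)"
        using closure_of_subset[OF img] by blast
    qed (rule closedin_closure_of)
    then show "(target d e closure_of (incidence_proj ` topspace ?T)) = topspace (target d e)"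
      by (simp add: topspace_target)
  qed
  moreover have "krull_dim (subtopology (ambient d e) (incidence_fiber d e \<alpha> \<beta>)) = 0"
    if "\<alpha> \<in> points d e" "\<beta> \<in> points d e" "meval (to_ac :: 'a \<Rightarrow> 'a alg_closure) \<alpha> (R2 d e) \<noteq> 0" for \<alpha> \<beta>
  proof (rule krull_dim_finite_T1)
    have top: "topspace (subtopology (ambient d e) (incidence_fiber d e \<alpha> \<beta>)) = incidence_fiber d e \<alpha> \<beta>"
      unfolding topspace_subtopology_ambient using inc by (auto simp: incidence_fiber_def)
    show "finite (topspace (subtopology (ambient d e) (incidence_fiber d e \<alpha> \<beta>)))"
      "topspace (subtopology (ambient d e) (incidence_fiber d e \<alpha> \<beta>)) \<noteq> {}"
      unfolding top using fib[OF that] by auto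
    fix z assume "z \<in> topspace (subtopology (ambient d e) (incidence_fiber d e \<alpha> \<beta>))"
    then have z: "z \<in> incidence_fiber d e \<alpha> \<beta>" "z \<in> ambient_set d e"
      using inc by (auto simp: top incidence_fiber_def)
    then show "closedin (subtopology (ambient d e) (incidence_fiber d e \<alpha> \<beta>)) {z}"
      using closedin_ambient_point[OF z(2)] by (auto simp: closedin_subtopology)
  qed
  ultimately show ?thesis by (simp add: npoints_def)
qed

end
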